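(* Let $\mathbb{X}=(X,g,\xi)$ be a gm-space and let $n\in\mathbb{N}$, $n\ge 1$. Then the quantization problem $$\mathrm{q}_n^{\mathrm{GW}}(\mathbb{X})=\inf_{\mathbb{Y}\in\mathfrak{GM}_n}\mathrm{GW}_2(\mathbb{X},\mathbb{Y})$$ admits a solution (the infimum is attained). Moreover, let $\hat{\mathbb{Y}}=([n],\hat G,\hat\upsilon)\in\mathfrak{GM}_n$ be any solution with fully supported $\hat\upsilon$ (i.e. $\hat\upsilon_i:=\hat\upsilon(\{i\})>0$ for all $i\in[n]$), and let $\hat\pi\in\Pi_{\mathrm o}(\mathbb{X},\hat{\mathbb{Y}})$. Then the following hold. (i) $\displaystyle \hat G_{i,i'}=\frac{1}{\hat\upsilon_i\hat\upsilon_{i'}}\iint_{X^2}g(x,x')\,\mathrm{d}\hat\pi_i(x)\,\mathrm{d}\hat\pi_{i'}(x')$ for all $i,i'\in[n]$. (ii) For every $i\in[n]$, the measure $\hat\pi_i$ is concentrated on $$A_i:=\Big\{x\in X:\hat c_i(x)=\min_{j\in[n]}\hat c_j(x)\Big\},\qquad \hat c_i(x):=\sum_{i'=1}^n\int_X\big(g(x,x')-\hat G_{i,i'}\big)^2\,\mathrm{d}\hat\pi_{i'}(x').$$ (iii) $\displaystyle \mathrm{q}_n^{\mathrm{GW}}(\mathbb{X})^2=\mathrm{GW}_2^2(\mathbb{X},\hat{\mathbb{Y}})=\iint_{X^2}g^2(x,x')\,\mathrm{d}\xi(x)\,\mathrm{d}\xi(x')-\sum_{i,i'=1}^n\hat G_{i,i'}^2\,\hat\upsilon_i\hat\upsilon_{i'}.$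 If additionally $\xi(A_i\cap A_j)=0$ for all $i\neq j$, then $\hat\pi=(\mathrm{Id},T)_\#\xi$, where $T(x)=i$ if $x\in V_i$, for the Voronoi partition $(V_i)_{i=1}^n$ of $X$ with respect to $(\hat c_i)_{i=1}^n$. In this case, $\hat\upsilon=\sum_{i=1}^n\xi(V_i)\,\delta_i$ and $$\hat G_{i,i'}=\frac{1}{\xi(V_i)\xi(V_{i'})}\iint_{V_i\times V_{i'}}g(x,x')\,\mathrm{d}\xi(x)\,\mathrm{d}\xi(x'),\qquad i,i'\in[n].$$
   Context: A gauged measure space (gm-space) is a triple $(X,g,\xi)$ where $X$ is a Polish space, $\xi$ is a Borel probability measure on $X$, and the gauge $g\in L^2(X\times X,\xi\otimes\xi)$ is symmetric. For gm-spaces $\mathbb{X}=(X,g,\xi)$ and $\mathbb{Y}=(Y,h,\upsilon)$, with $\Pi(\xi,\upsilon)$ the set of couplings (probability measures on $X\times Y$ with marginals $\xi$ and $\upsilon$), $$\mathrm{GW}_2(\mathbb{X},\mathbb{Y})=\inf_{\pi\in\Pi(\xi,\upsilon)}\Big(\iint_{(X\times Y)^2}|g(x,x')-h(y,y')|^2\,\mathrm{d}\pi(x,y)\,\mathrm{d}\pi(x',y')\Big)^{1/2}.$$ The infimum is always attained; $\Pi_{\mathrm o}(\mathbb{X},\mathbb{Y})$ denotes the set of minimizers. Write $[n]=\{1,\dots,n\}$. $\mathfrak{GM}_n$ is the set of gm-spaces $([n],G,\upsilon)$ with $G\in\mathbb{R}^{n\times n}$ a symmetric matrix (viewed as the gauge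 $(i,i')\mapsto G_{i,i'}$) and $\upsilon$ a probability measure on $[n]$. For a measure $\pi$ on $X\times[n]$, $\pi_i:=\pi(\cdot\times\{i\})$, a finite measure on $X$. A measure is concentrated on $A$ if the complement of $A$ has measure zero. For functions $(c_i)_{i=1}^n$ on $X$, the associated Voronoi partition $(V_i)_{i=1}^n$ of $X$ is $V_i:=T^{-1}(\{i\})$ with $T(x):=\min\{i\in[n]:c_i(x)=\min_{j\in[n]}c_j(x)\}$. *)

theory Defs
  imports "HOL-Analysis.Analysis" "HOL-Probability.Probability"
begin

text \<open>A Polish space is given as an abstract topology, so that the finite discrete spaces
  \<^term>\<open>{1..n::nat}\<close> are covered too.\<close>

definition polish_topology :: "'a topology \<Rightarrow> bool" where
  "polish_topology X \<longleftrightarrow> completely_metrizable_space X \<and> separable_space X"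

type_synonym 'a gm = "'a topology \<times> ('a \<Rightarrow> 'a \<Rightarrow> real) \<times> 'a measure"

text \<open>The gauge is an \<open>L\<^sup>2\<close> class. It is given here by a Borel representative, and symmetry is
  therefore only required almost everywhere.\<close>

fun gm_space :: "'a gm \<Rightarrow> bool" where
  "gm_space (X, g, \<xi>) \<longleftrightarrow>
     polish_topology X \<and>
     sets \<xi> = sigma_sets (topspace X) {U. openin X U} \<and>
     prob_space \<xi> \<and>
     (\<lambda>(x, x'). g x x') \<in> borel_measurable (\<xi> \<Otimes>\<^sub>M \<xi>) \<and>
     integrable (\<xi> \<Otimes>\<^sub>M \<xi>) (\<lambda>(x, x'). (g x x')\<^sup>2) \<and>
     (AE (x, x') in \<xi> \<Otimes>\<^sub>M \<xi>. g x x' = g x' x)"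

definition couplings :: "'a measure \<Rightarrow> 'b measure \<Rightarrow> ('a \<times> 'b) measure set" where
  "couplings \<xi> \<upsilon> =
     {\<pi>. sets \<pi> = sets (\<xi> \<Otimes>\<^sub>M \<upsilon>) \<and> prob_space \<pi> \<and> distr \<pi> \<xi> fst = \<xi> \<and> distr \<pi> \<upsilon> snd = \<upsilon>}"

definition gw_cost ::
  "('a \<Rightarrow> 'a \<Rightarrow> real) \<Rightarrow> ('b \<Rightarrow> 'b \<Rightarrow> real) \<Rightarrow> ('a \<times> 'b) measure \<Rightarrow> real" where
  "gw_cost g h \<pi> = sqrt (\<integral>((x, y), (x', y')). \<bar>g x x' - h y y'\<bar>\<^sup>2 \<partial>(\<pi> \<Otimes>\<^sub>M \<pi>))"

text \<open>For gm-spaces the integrand above is integrable for every coupling, and the product measure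
  is a coupling; so the following is a real infimum over a nonempty set that is bounded below.\<close>

fun GW2 :: "'a gm \<Rightarrow> 'b gm \<Rightarrow> real" where
  "GW2 (X, g, \<xi>) (Y, h, \<upsilon>) = (INF \<pi>\<in>couplings \<xi> \<upsilon>. gw_cost g h \<pi>)"

fun optimal_couplings :: "'a gm \<Rightarrow> 'b gm \<Rightarrow> ('a \<times> 'b) measure set" where
  "optimal_couplings (X, g, \<xi>) (Y, h, \<upsilon>) =
     {\<pi> \<in> couplings \<xi> \<upsilon>. \<forall>\<rho>\<in>couplings \<xi> \<upsilon>. gw_cost g h \<pi> \<le> gw_cost g h \<rho>}"

text \<open>A matrix in \<open>\<real>\<^sup>n\<^sup>\<times>\<^sup>n\<close> is a function of two indices of which only the values on
  \<^term>\<open>{1..n}\<close> matter.\<close>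

definition GM :: "nat \<Rightarrow> nat gm set" where
  "GM n = {(discrete_topology {1..n}, G, \<upsilon>) | G \<upsilon>.
     (\<forall>i\<in>{1..n}. \<forall>i'\<in>{1..n}. G i i' = G i' i) \<and> sets \<upsilon> = Pow {1..n} \<and> prob_space \<upsilon>}"

definition q_GW :: "nat \<Rightarrow> 'a gm \<Rightarrow> real" where
  "q_GW n \<X> = (INF \<Y>\<in>GM n. GW2 \<X> \<Y>)"

lemma GM_gm_space:
  assumes "\<Y> \<in> GM n"
  shows "gm_space \<Y>"
proof -
  obtain G \<upsilon> where Y: "\<Y> = (discrete_topology {1..n}, G, \<upsilon>)"
    and sym: "\<forall>i\<in>{1..n}. \<forall>i'\<in>{1..n}. G i i' = G i' i"
    and sets: "sets \<upsilon> = Pow {1..n}" and "prob_space \<upsilon>"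
    using assms by (auto simp: GM_def)
  interpret prob_space \<upsilon> by fact
  interpret P: pair_prob_space \<upsilon> \<upsilon> ..
  have space: "space \<upsilon> = {1..n}"
    using sets_eq_imp_space_eq[of \<upsilon> "count_space {1..n}"] sets by simp
  have "sets (\<upsilon> \<Otimes>\<^sub>M \<upsilon>) = sets (count_space {1..n} \<Otimes>\<^sub>M count_space {1..n})"
    by (intro sets_pair_measure_cong) (simp_all add: sets)
  also have "\<dots> = sets (count_space ({1..n} \<times> {1..n}))"
    by (simp only: pair_measure_countable countable_finite finite_atLeastAtMost)
  finally have prod: "sets (\<upsilon> \<Otimes>\<^sub>M \<upsilon>) = sets (count_space ({1..n} \<times> {1..n}))" .
  have meas: "f \<in> borel_measurable (\<upsilon> \<Otimes>\<^sub>M \<upsilon>)" for f :: "nat \<times> nat \<Rightarrow> real"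
    by (simp add: measurable_cong_sets[OF prod refl])
  have int: "integrable (\<upsilon> \<Otimes>\<^sub>M \<upsilon>) f" for f :: "nat \<times> nat \<Rightarrow> real"
  proof (rule P.integrable_const_bound)
    show "AE z in \<upsilon> \<Otimes>\<^sub>M \<upsilon>. norm (f z) \<le> Max (norm ` f ` ({1..n} \<times> {1..n}))"
      by (rule AE_I2) (auto simp: space_pair_measure space intro!: Max_ge)
  qed (rule meas)
  have "polish_topology (discrete_topology {1..n})"
    by (auto simp: polish_topology_def completely_metrizable_space_discrete_topology
        separable_space_discrete_topology)
  moreover have "Collect (openin (discrete_topology {1..n})) = Pow {1..n}"
    by (rule set_eqI) (simp add: Pow_def)
  then have "sigma_sets {1..n} (Collect (openin (discrete_topology {1..n}))) = Pow {1..n}"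
    by (metis sigma_algebra.sigma_sets_eq sigma_algebra_Pow)
  moreover have "AE (x, x') in \<upsilon> \<Otimes>\<^sub>M \<upsilon>. G x x' = G x' x"
    using sym by (intro AE_I2) (auto simp: space_pair_measure space)
  ultimately show ?thesis
    using Y sets meas int \<open>prob_space \<upsilon>\<close> by simp
qed

text \<open>For \<open>\<pi>\<close> on \<open>X \<times> [n]\<close>, the measure \<open>\<pi>\<^sub>i = \<pi>(\<cdot> \<times> {i})\<close> on \<open>X\<close>; the first argument only
  provides \<open>X\<close> and its Borel sets.\<close>

definition slice :: "'a measure \<Rightarrow> ('a \<times> 'b) measure \<Rightarrow> 'b \<Rightarrow> 'a measure" where
  "slice \<xi> \<pi> i = measure_of (space \<xi>) (sets \<xi>) (\<lambda>A. emeasure \<pi> (A \<times> {i}))"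

lemma emeasure_slice:
  assumes "sets \<pi> = sets (\<xi> \<Otimes>\<^sub>M \<upsilon>)" "{i} \<in> sets \<upsilon>" "A \<in> sets \<xi>"
  shows "emeasure (slice \<xi> \<pi> i) A = emeasure \<pi> (A \<times> {i})"
proof -
  have "countably_additive (sets \<xi>) (\<lambda>A. emeasure \<pi> (A \<times> {i}))"
  proof (rule countably_additiveI)
    fix B :: "nat \<Rightarrow> 'a set"
    assume B: "range B \<subseteq> sets \<xi>" "disjoint_family B"
    have "range (\<lambda>k. B k \<times> {i}) \<subseteq> sets \<pi>"
      using B(1) assms by auto
    moreover have "disjoint_family (\<lambda>k. B k \<times> {i})"
      using B(2) by (auto simp: disjoint_family_on_def)
    ultimately have "(\<Sum>k. emeasure \<pi> (B k \<times> {i})) = emeasure \<pi> (\<Union>k. B k \<times> {i})"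
      by (rule suminf_emeasure)
    also have "(\<Union>k. B k \<times> {i}) = (\<Union>k. B k) \<times> {i}"
      by auto
    finally show "(\<Sum>k. emeasure \<pi> (B k \<times> {i})) = emeasure \<pi> ((\<Union>k. B k) \<times> {i})" .
  qed
  then show ?thesis
    unfolding slice_def using assms(3)
    by (intro emeasure_measure_of_sigma sets.sigma_algebra_axioms) (auto simp: positive_def)
qed

definition concentrated_on :: "'a measure \<Rightarrow> 'a set \<Rightarrow> bool" where
  "concentrated_on \<mu> A \<longleftrightarrow> space \<mu> - A \<in> null_sets \<mu>"

text \<open>The functions \<open>c\<^sub>i\<close>. The integrals may be infinite for \<open>x\<close> in a null set, hence the values
  in \<^typ>\<open>ennreal\<close>.\<close>

definition quant_cost ::
  "nat \<Rightarrow> ('a \<Rightarrow> 'a \<Rightarrow> real) \<Rightarrow> 'a measure \<Rightarrow> (nat \<Rightarrow> nat \<Rightarrow> real) \<Rightarrow> ('a \<times> nat) measure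
    \<Rightarrow> nat \<Rightarrow> 'a \<Rightarrow> ennreal" where
  "quant_cost n g \<xi> G \<pi> i x =
     (\<Sum>i'\<in>{1..n}. \<integral>\<^sup>+x'. ennreal ((g x x' - G i i')\<^sup>2) \<partial>slice \<xi> \<pi> i')"

definition argmin_set ::
  "'a topology \<Rightarrow> nat \<Rightarrow> (nat \<Rightarrow> 'a \<Rightarrow> 'c::linorder) \<Rightarrow> nat \<Rightarrow> 'a set" where
  "argmin_set X n c i = {x \<in> topspace X. c i x = (MIN j\<in>{1..n}. c j x)}"

definition voronoi_index :: "nat \<Rightarrow> (nat \<Rightarrow> 'a \<Rightarrow> 'c::linorder) \<Rightarrow> 'a \<Rightarrow> nat" where
  "voronoi_index n c x = Min {i \<in> {1..n}. c i x = (MIN j\<in>{1..n}. c j x)}"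

definition voronoi_cell ::
  "'a topology \<Rightarrow> nat \<Rightarrow> (nat \<Rightarrow> 'a \<Rightarrow> 'c::linorder) \<Rightarrow> nat \<Rightarrow> 'a set" where
  "voronoi_cell X n c i = {x \<in> topspace X. voronoi_index n c x = i}"

end

theory Submission
  imports Defs
begin

text \<open>A coupling of \<open>\<xi>\<close> with some measure on \<open>[n]\<close> is the same thing as a measure \<open>\<pi>\<close> on \<open>X \<times> [n]\<close> whose
first marginal is \<open>\<xi>\<close>; such a measure is called a plan below. Since the weights of the quantizer
are free, they can be read off as the second marginal of \<open>\<pi>\<close>, and the quantization problem becomes
the joint minimization, over all plans \<open>\<pi>\<close> and all matrices \<open>G\<close>, of the distortion
\<open>\<Sum>\<^sub>i\<^sub>j \<integral>(g - G\<^sub>i\<^sub>j)\<^sup>2 d(\<pi>\<^sub>i \<otimes> \<pi>\<^sub>j)\<close>, where \<open>\<pi>\<^sub>i\<close> are the slices of \<open>\<pi>\<close> (\<open>gw_cost_eq_distortion\<close>).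

For a fixed plan the distortion is a separate quadratic polynomial in each entry \<open>G\<^sub>i\<^sub>j\<close>, with leading
coefficient \<open>\<upsilon>\<^sub>i \<upsilon>\<^sub>j\<close> and with vertex at the mean of \<open>g\<close> over \<open>\<pi>\<^sub>i \<otimes> \<pi>\<^sub>j\<close>
(\<open>optimal_gauge_is_mean\<close>). This gives (i), and (iii) is the value at the vertex
(\<open>distortion_at_mean\<close>): the integral of \<open>g\<^sup>2\<close> against \<open>\<pi> \<otimes> \<pi>\<close> only sees the first marginals.

For a fixed symmetric matrix the distortion is a quadratic form in the plan, with the symmetric
kernel \<open>(g(x,x') - G\<^sub>i\<^sub>j)\<^sup>2\<close>. Differentiating along the segment from a minimizer \<open>\<pi>\<close> to another plan
\<open>\<rho>\<close> shows that \<open>\<pi>\<close> minimizes the linear functional \<open>\<rho> \<mapsto> \<integral>c\<^sub>i(x) d\<rho>(x,i)\<close>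
(\<open>first_variation\<close>). The minimal value of that functional is \<open>\<integral> min\<^sub>j c\<^sub>j d\<xi>\<close>, which the plan sending
\<open>x\<close> to its Voronoi index reaches, so \<open>c\<^sub>i(x) = min\<^sub>j c\<^sub>j(x)\<close> holds \<open>\<pi>\<close>-almost everywhere; this is (ii).
If the minimizing index is almost surely unique, the second coordinate is a function of the first,
\<open>\<pi>\<close> is carried by the graph of the Voronoi index, and its slices are the restrictions of \<open>\<xi>\<close> to
the Voronoi cells.

Existence rests on compactness. All slices of plans are dominated by the one probability measure
\<open>\<xi>\<close>. Regarded as set functions they live in a product of compact intervals, so by Tychonoff's
theorem every sequence of plans converges setwise along some filter finer than \<open>sequentially\<close>.
Domination makes the limit countably additive (\<open>setwise_cluster_measure\<close>) and carries the convergence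
over to products (\<open>setwise_tendsto_pair_measure\<close>) and to integrals of functions that are integrable
for \<open>\<xi> \<otimes> \<xi>\<close> (\<open>setwise_tendsto_integral\<close>). Along a minimizing sequence the matrices may be
unbounded, in particular if the weight of an index tends to zero; but every term of the distortion can
be bounded below by its minimum over \<open>G\<^sub>i\<^sub>j\<close>, or by \<open>0\<close> if the limiting weight vanishes, and these
bounds converge (\<open>block_distortion_lower_limit\<close>).\<close>

section \<open>Setwise convergence of dominated measures\<close>

lemma nn_integral_le_measure_finite:
  fixes f :: "'a \<Rightarrow> ennreal"
  assumes "sets \<alpha> = sets \<mu>" "\<alpha> \<le> \<mu>" "(\<integral>\<^sup>+x. f x \<partial>\<mu>) < \<infinity>"
  shows "(\<integral>\<^sup>+x. f x \<partial>\<alpha>) < \<infinity>"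
  using nn_integral_mono_measure[OF assms(1,2), of f] assms(3) by (rule le_less_trans)

lemma integrable_le_measure:
  fixes f :: "'a \<Rightarrow> real"
  assumes "sets \<alpha> = sets \<mu>" "\<alpha> \<le> \<mu>" "integrable \<mu> f"
  shows "integrable \<alpha> f"
  using assms nn_integral_le_measure_finite[OF assms(1,2), of "\<lambda>x. ennreal (norm (f x))"]
  by (simp add: integrable_iff_bounded measurable_cong_sets[OF assms(1) refl])

lemma finite_measure_le_measure:
  assumes "finite_measure \<mu>" "sets \<alpha> = sets \<mu>" "\<alpha> \<le> \<mu>"
  shows "finite_measure \<alpha>"
proof (rule finite_measureI)
  have "emeasure \<alpha> (space \<alpha>) \<le> emeasure \<mu> (space \<mu>)"
    using le_measureD3[OF assms(3,2)] sets_eq_imp_space_eq[OF assms(2)] by metis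
  also have "\<dots> < \<infinity>"
    using finite_measure.emeasure_finite[OF assms(1)] by (simp add: less_top[symmetric])
  finally show "emeasure \<alpha> (space \<alpha>) \<noteq> \<infinity>" by simp
qed

lemma AE_le_measure:
  assumes "sets \<alpha> = sets \<mu>" "\<alpha> \<le> \<mu>" "AE x in \<mu>. P x"
  shows "AE x in \<alpha>. P x"
proof -
  obtain N where N: "N \<in> null_sets \<mu>" "{x \<in> space \<mu>. \<not> P x} \<subseteq> N"
    using assms(3) by (auto simp: eventually_ae_filter)
  have "emeasure \<alpha> N \<le> emeasure \<mu> N" using le_measureD3[OF assms(2,1)] .
  then have "N \<in> null_sets \<alpha>" using N(1) assms(1) by (auto simp: null_sets_def)
  then show ?thesis
    using N(2) sets_eq_imp_space_eq[OF assms(1)] by (auto intro!: AE_I')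
qed

text \<open>Products of dominated measures are again dominated, which lets the convergence lemmas be used for
\<open>\<pi>\<^sub>i \<otimes> \<pi>\<^sub>j\<close>.\<close>

lemma pair_measure_mono:
  assumes "finite_measure \<mu>" "finite_measure \<nu>"
    and \<alpha>: "sets \<alpha> = sets \<mu>" "\<alpha> \<le> \<mu>" and \<beta>: "sets \<beta> = sets \<nu>" "\<beta> \<le> \<nu>"
  shows "\<alpha> \<Otimes>\<^sub>M \<beta> \<le> \<mu> \<Otimes>\<^sub>M \<nu>"
proof -
  interpret \<mu>: finite_measure \<mu> by fact
  interpret \<nu>: finite_measure \<nu> by fact
  interpret \<beta>: finite_measure \<beta> by (rule finite_measure_le_measure[OF assms(2) \<beta>])
  have sets: "sets (\<alpha> \<Otimes>\<^sub>M \<beta>) = sets (\<mu> \<Otimes>\<^sub>M \<nu>)"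
    by (intro sets_pair_measure_cong \<alpha> \<beta>)
  have "emeasure (\<alpha> \<Otimes>\<^sub>M \<beta>) S \<le> emeasure (\<mu> \<Otimes>\<^sub>M \<nu>) S" if S: "S \<in> sets (\<mu> \<Otimes>\<^sub>M \<nu>)" for S
  proof -
    have "emeasure (\<alpha> \<Otimes>\<^sub>M \<beta>) S = (\<integral>\<^sup>+x. emeasure \<beta> (Pair x -` S) \<partial>\<alpha>)"
      using S sets by (intro \<beta>.emeasure_pair_measure_alt) simp
    also have "\<dots> \<le> (\<integral>\<^sup>+x. emeasure \<beta> (Pair x -` S) \<partial>\<mu>)"
      by (rule nn_integral_mono_measure[OF \<alpha>])
    also have "\<dots> \<le> (\<integral>\<^sup>+x. emeasure \<nu> (Pair x -` S) \<partial>\<mu>)"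
      by (intro nn_integral_mono le_measureD3[OF \<beta>(2,1)])
    also have "\<dots> = emeasure (\<mu> \<Otimes>\<^sub>M \<nu>) S"
      using S by (intro \<nu>.emeasure_pair_measure_alt[symmetric])
    finally show ?thesis .
  qed
  then show ?thesis by (simp add: le_measure sets)
qed

lemma measure_mono_le_measure:
  assumes "finite_measure \<mu>" "sets \<alpha> = sets \<mu>" "\<alpha> \<le> \<mu>"
  shows "measure \<alpha> A \<le> measure \<mu> A"
  unfolding measure_def
  by (intro enn2real_mono le_measureD3[OF assms(3,2)])
     (simp add: finite_measure.emeasure_finite[OF assms(1)] less_top[symmetric])

text \<open>Domination supplies the summable majorant \<open>\<mu> (A m)\<close> in Tannery's theorem, so limits along an arbitrary
filter commute with countable disjoint unions.\<close>

lemma dominated_measure_UNION_tendsto: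
  assumes "finite_measure \<mu>"
    and \<alpha>: "\<And>k. sets (\<alpha> k) = sets \<mu>" "\<And>k. \<alpha> k \<le> \<mu>"
    and "F \<noteq> bot"
    and A: "range A \<subseteq> sets \<mu>" "disjoint_family (A :: nat \<Rightarrow> 'a set)"
    and lim: "\<And>m. ((\<lambda>k. measure (\<alpha> k) (A m)) \<longlongrightarrow> b m) F"
  shows "summable b" "((\<lambda>k. measure (\<alpha> k) (\<Union>m. A m)) \<longlongrightarrow> (\<Sum>m. b m)) F"
proof -
  interpret \<mu>: finite_measure \<mu> by fact
  have *: "eventually (\<lambda>n. summable (\<lambda>m. norm (measure (\<alpha> n) (A m)))) F \<and>
           summable (\<lambda>n. norm (b n)) \<and>
           ((\<lambda>n. suminf (\<lambda>m. measure (\<alpha> n) (A m))) \<longlongrightarrow> suminf b) F"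
  proof (rule tannerys_theorem[where M = "\<lambda>m. measure \<mu> (A m)"])
    show "eventually (\<lambda>(m, k). norm (measure (\<alpha> k) (A m)) \<le> measure \<mu> (A m)) (at_top \<times>\<^sub>F F)"
      by (intro always_eventually) (auto intro!: measure_mono_le_measure \<alpha> assms(1))
    show "summable (\<lambda>m. measure \<mu> (A m))"
      using \<mu>.finite_measure_UNION[OF A] by (rule sums_summable)
  qed fact+
  have "(\<Sum>m. measure (\<alpha> k) (A m)) = measure (\<alpha> k) (\<Union>m. A m)" for k
  proof -
    interpret k: finite_measure "\<alpha> k" by (rule finite_measure_le_measure[OF assms(1) \<alpha>])
    show ?thesis using k.finite_measure_UNION[of A] A \<alpha> by (simp add: sums_iff)
  qed
  then show "summable b" "((\<lambda>k. measure (\<alpha> k) (\<Union>m. A m)) \<longlongrightarrow> (\<Sum>m. b m)) F"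
    using * by (auto intro: summable_norm_cancel)
qed

text \<open>Compactness of dominated measures: the set functions \<open>A \<mapsto> \<alpha> k A\<close> lie in a product of compact
intervals, and a cluster point in the product topology is a limit along a filter finer than
\<open>sequentially\<close>. That filter replaces a convergent subsequence, and the limit is countably additive by
\<open>dominated_measure_UNION_tendsto\<close>.\<close>

lemma setwise_cluster_measure:
  fixes \<alpha> :: "nat \<Rightarrow> 'a measure"
  assumes "finite_measure \<mu>" "\<And>k. sets (\<alpha> k) = sets \<mu>" "\<And>k. \<alpha> k \<le> \<mu>"
  obtains F \<beta> where "F \<noteq> bot" "F \<le> sequentially" "sets \<beta> = sets \<mu>" "\<beta> \<le> \<mu>"
    "\<And>A. A \<in> sets \<mu> \<Longrightarrow> ((\<lambda>k. measure (\<alpha> k) A) \<longlongrightarrow> measure \<beta> A) F"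
proof -
  interpret \<mu>: finite_measure \<mu> by fact
  define f where "f = (\<lambda>k A. measure (\<alpha> k) A)"
  define U :: "('a set \<Rightarrow> real) set" where "U = (UNIV \<rightarrow>\<^sub>E {0..measure \<mu> (space \<mu>)})"
  \<comment> \<open>Tychonoff's theorem for the product of the intervals over all subsets of the space.\<close>
  have "compact U"
    unfolding U_def compactin_euclidean_iff[symmetric] euclidean_product_topology[symmetric]
      compactin_PiE by simp
  moreover have "f k \<in> U" for k
    using order_trans[OF measure_mono_le_measure[OF assms] \<mu>.bounded_measure]
    by (auto simp: U_def f_def)
  then have "eventually (\<lambda>x. x \<in> U) (filtermap f sequentially)"
    by (simp add: eventually_filtermap)
  moreover have "filtermap f sequentially \<noteq> bot"
    by (simp add: filtermap_bot_iff)
  ultimately obtain \<nu> where \<nu>: "inf (nhds \<nu>) (filtermap f sequentially) \<noteq> bot"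
    unfolding compact_filter by blast
  \<comment> \<open>The indices \<open>k\<close> that are large and for which \<open>f k\<close> is close to \<open>\<nu>\<close>.\<close>
  define F where "F = inf sequentially (filtercomap f (nhds \<nu>))"
  have F: "F \<noteq> bot"
  proof
    assume "F = bot"
    then have "eventually (\<lambda>_. False) F" by simp
    then obtain P Q where PQ: "eventually P sequentially" "eventually Q (nhds \<nu>)"
      "\<And>k. P k \<Longrightarrow> Q (f k) \<Longrightarrow> False"
      unfolding F_def eventually_inf eventually_filtercomap by blast
    have "eventually (\<lambda>x. \<not> Q x) (filtermap f sequentially)"
      unfolding eventually_filtermap by (rule eventually_mono[OF PQ(1)]) (use PQ(3) in blast)
    then have "eventually (\<lambda>_. False) (inf (nhds \<nu>) (filtermap f sequentially))"
      unfolding eventually_inf using PQ(2) by blast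
    with \<nu> show False by (simp add: trivial_limit_def)
  qed
  have "filterlim f (nhds \<nu>) F"
    unfolding filterlim_iff_le_filtercomap F_def by simp
  then have lim: "((\<lambda>k. measure (\<alpha> k) A) \<longlongrightarrow> \<nu> A) F" for A
    using continuous_on_tendsto_compose[OF continuous_on_product_coordinates[of A], of f \<nu> F]
    by (simp add: f_def)
  have nonneg: "0 \<le> \<nu> A" for A
    by (rule tendsto_lowerbound[OF lim _ F]) simp
  have le: "\<nu> A \<le> measure \<mu> A" for A
    by (rule tendsto_upperbound[OF lim _ F])
       (intro always_eventually allI measure_mono_le_measure assms)
  define \<beta> where "\<beta> = measure_of (space \<mu>) (sets \<mu>) (\<lambda>A. ennreal (\<nu> A))"
  have sets: "sets \<beta> = sets \<mu>"
    unfolding \<beta>_def by simp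
  have em: "emeasure \<beta> A = ennreal (\<nu> A)" if "A \<in> sets \<mu>" for A
    unfolding \<beta>_def
  proof (rule emeasure_measure_of_sigma[OF sets.sigma_algebra_axioms _ _ that])
    have "\<nu> {} = 0"
      using le[of "{}"] nonneg[of "{}"] by simp
    then show "positive (sets \<mu>) (\<lambda>A. ennreal (\<nu> A))"
      by (simp add: positive_def)
    show "countably_additive (sets \<mu>) (\<lambda>A. ennreal (\<nu> A))"
    proof (rule countably_additiveI)
      fix A :: "nat \<Rightarrow> 'a set" assume A: "range A \<subseteq> sets \<mu>" "disjoint_family A"
      note * = dominated_measure_UNION_tendsto[OF assms(1-3) F A lim]
      have "(\<Sum>m. \<nu> (A m)) = \<nu> (\<Union>m. A m)"
        by (rule tendsto_unique[OF F *(2) lim])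
      then show "(\<Sum>m. ennreal (\<nu> (A m))) = ennreal (\<nu> (\<Union>m. A m))"
        using nonneg *(1) by (simp add: suminf_ennreal2)
    qed
  qed
  show thesis
  proof (rule that)
    show "F \<noteq> bot" "F \<le> sequentially" "sets \<beta> = sets \<mu>" by (fact F, simp add: F_def, fact sets)
    show "\<beta> \<le> \<mu>"
      using le by (auto simp: le_measure sets em \<mu>.emeasure_eq_measure intro!: ennreal_leI)
    show "((\<lambda>k. measure (\<alpha> k) A) \<longlongrightarrow> measure \<beta> A) F" if "A \<in> sets \<mu>" for A
      using lim[of A] nonneg by (simp add: measure_def[of \<beta>] em[OF that])
  qed
qed

text \<open>Under domination, approximating the integrand in \<open>L\<^sup>1(\<mu>)\<close> is uniformly good for all the measures
involved, so it is enough to know the convergence for indicators.\<close>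

lemma setwise_tendsto_integral:
  fixes f :: "'a \<Rightarrow> real"
  assumes \<alpha>: "\<And>k. sets (\<alpha> k) = sets \<mu>" "\<And>k. \<alpha> k \<le> \<mu>"
    and \<beta>: "sets \<beta> = sets \<mu>" "\<beta> \<le> \<mu>"
    and lim: "\<And>A. A \<in> sets \<mu> \<Longrightarrow> ((\<lambda>k. measure (\<alpha> k) A) \<longlongrightarrow> measure \<beta> A) F"
    and "integrable \<mu> f"
  shows "((\<lambda>k. \<integral>x. f x \<partial>\<alpha> k) \<longlongrightarrow> (\<integral>x. f x \<partial>\<beta>)) F"
  using \<open>integrable \<mu> f\<close>
proof (induct rule: integrable_induct)
  case (base A c)
  have "A \<in> sets (\<alpha> k)" "A \<in> sets \<beta>" for k using base \<alpha> \<beta> by auto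
  then show ?case using tendsto_mult_right[OF lim[OF base(1)]]
    by (auto simp: mult.commute)
next
  case (add f g)
  note int = integrable_le_measure[OF \<alpha>] integrable_le_measure[OF \<beta>]
  have "(\<lambda>k. \<integral>x. f x + g x \<partial>\<alpha> k) = (\<lambda>k. (\<integral>x. f x \<partial>\<alpha> k) + (\<integral>x. g x \<partial>\<alpha> k))"
    using add int(1) by (intro ext Bochner_Integration.integral_add)
  moreover have "(\<integral>x. f x + g x \<partial>\<beta>) = (\<integral>x. f x \<partial>\<beta>) + (\<integral>x. g x \<partial>\<beta>)"
    using add int(2) by (intro Bochner_Integration.integral_add)
  ultimately show ?case
    using tendsto_add[OF add(2,4)] by simp
next
  case (lim f s)
  note int = integrable_le_measure[OF \<alpha>] integrable_le_measure[OF \<beta>]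
  \<comment> \<open>The error of replacing \<open>f\<close> by \<open>s m\<close>, uniformly over all measures dominated by \<open>\<mu>\<close>.\<close>
  have close: "\<bar>(\<integral>x. s m x \<partial>\<gamma>) - (\<integral>x. f x \<partial>\<gamma>)\<bar> \<le> (\<integral>x. \<bar>s m x - f x\<bar> \<partial>\<mu>)"
    if \<gamma>: "sets \<gamma> = sets \<mu>" "\<gamma> \<le> \<mu>" for \<gamma> m
  proof -
    have int\<gamma>: "integrable \<gamma> (s m)" "integrable \<gamma> f"
      using integrable_le_measure[OF \<gamma>] lim by auto
    have "\<bar>(\<integral>x. s m x \<partial>\<gamma>) - (\<integral>x. f x \<partial>\<gamma>)\<bar> = \<bar>\<integral>x. s m x - f x \<partial>\<gamma>\<bar>"
      using int\<gamma> by simp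
    also have "\<dots> \<le> (\<integral>x. \<bar>s m x - f x\<bar> \<partial>\<gamma>)"
      using integral_norm_bound[of \<gamma> "\<lambda>x. s m x - f x"] by simp
    also have "\<dots> \<le> (\<integral>x. \<bar>s m x - f x\<bar> \<partial>\<mu>)"
    proof -
      have "(\<integral>x. \<bar>s m x - f x\<bar> \<partial>\<gamma>) = enn2real (\<integral>\<^sup>+x. \<bar>s m x - f x\<bar> \<partial>\<gamma>)"
        using int\<gamma> by (intro integral_eq_nn_integral) auto
      also have "\<dots> \<le> enn2real (\<integral>\<^sup>+x. \<bar>s m x - f x\<bar> \<partial>\<mu>)"
      proof (intro enn2real_mono nn_integral_mono_measure \<gamma>)
        have "integrable \<mu> (\<lambda>x. s m x - f x)" using lim by auto
        then show "(\<integral>\<^sup>+x. \<bar>s m x - f x\<bar> \<partial>\<mu>) < top"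
          by (auto simp: integrable_iff_bounded)
      qed
      also have "\<dots> = (\<integral>x. \<bar>s m x - f x\<bar> \<partial>\<mu>)"
        using lim by (intro integral_eq_nn_integral[symmetric]) auto
      finally show ?thesis .
    qed
    finally show ?thesis .
  qed
  \<comment> \<open>The approximants satisfy \<open>\<bar>s m x\<bar> \<le> 2 * \<bar>f x\<bar>\<close>, hence the majorant \<open>3 * \<bar>f x\<bar>\<close>.\<close>
  have L1: "(\<lambda>m. \<integral>x. \<bar>s m x - f x\<bar> \<partial>\<mu>) \<longlonglongrightarrow> (\<integral>x. 0 \<partial>\<mu>)"
  proof (rule integral_dominated_convergence[where w = "\<lambda>x. 3 * \<bar>f x\<bar>"])
    show "AE x in \<mu>. (\<lambda>m. \<bar>s m x - f x\<bar>) \<longlonglongrightarrow> 0"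
      by (intro AE_I2 tendsto_rabs_zero LIM_zero lim(3))
    show "AE x in \<mu>. norm \<bar>s m x - f x\<bar> \<le> 3 * \<bar>f x\<bar>" for m
    proof (rule AE_I2)
      fix x assume "x \<in> space \<mu>"
      then have "\<bar>s m x\<bar> \<le> 2 * \<bar>f x\<bar>" using lim(4)[of x m] by simp
      then show "norm \<bar>s m x - f x\<bar> \<le> 3 * \<bar>f x\<bar>" by simp
    qed
  qed (use lim in auto)
  show ?case
  proof (rule tendstoI)
    fix e :: real assume "e > 0"
    then have "eventually (\<lambda>m. (\<integral>x. \<bar>s m x - f x\<bar> \<partial>\<mu>) < e / 3) sequentially"
      using order_tendstoD(2)[OF L1, of "e / 3"] by simp
    then obtain m where m: "(\<integral>x. \<bar>s m x - f x\<bar> \<partial>\<mu>) < e / 3"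
      by (auto simp: eventually_sequentially)
    have "eventually (\<lambda>k. dist (\<integral>x. s m x \<partial>\<alpha> k) (\<integral>x. s m x \<partial>\<beta>) < e / 3) F"
      using lim(2)[of m] \<open>e > 0\<close> by (intro tendstoD) auto
    then show "eventually (\<lambda>k. dist (\<integral>x. f x \<partial>\<alpha> k) (\<integral>x. f x \<partial>\<beta>) < e) F"
    proof (rule eventually_mono)
      fix k assume "dist (\<integral>x. s m x \<partial>\<alpha> k) (\<integral>x. s m x \<partial>\<beta>) < e / 3"
      then show "dist (\<integral>x. f x \<partial>\<alpha> k) (\<integral>x. f x \<partial>\<beta>) < e"
        using close[OF \<alpha>, of k m] close[OF \<beta>, of m] m unfolding dist_real_def by argo
    qed
  qed
qed

text \<open>On a rectangle the limit is a product of two limits, and by domination the sets on which the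
convergence holds form a Dynkin system.\<close>

lemma setwise_tendsto_pair_measure:
  assumes "finite_measure \<mu>" "finite_measure \<nu>" "F \<noteq> bot"
    and \<alpha>: "\<And>k. sets (\<alpha> k) = sets \<mu>" "\<And>k. \<alpha> k \<le> \<mu>"
    and \<beta>: "\<And>k. sets (\<beta> k) = sets \<nu>" "\<And>k. \<beta> k \<le> \<nu>"
    and \<alpha>': "sets \<alpha>' = sets \<mu>" "\<alpha>' \<le> \<mu>" and \<beta>': "sets \<beta>' = sets \<nu>" "\<beta>' \<le> \<nu>"
    and lim: "\<And>A. A \<in> sets \<mu> \<Longrightarrow> ((\<lambda>k. measure (\<alpha> k) A) \<longlongrightarrow> measure \<alpha>' A) F"
      "\<And>A. A \<in> sets \<nu> \<Longrightarrow> ((\<lambda>k. measure (\<beta> k) A) \<longlongrightarrow> measure \<beta>' A) F"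
    and S: "S \<in> sets (\<mu> \<Otimes>\<^sub>M \<nu>)"
  shows "((\<lambda>k. measure (\<alpha> k \<Otimes>\<^sub>M \<beta> k) S) \<longlongrightarrow> measure (\<alpha>' \<Otimes>\<^sub>M \<beta>') S) F"
proof -
  interpret \<mu>: finite_measure \<mu> by fact
  interpret \<nu>: finite_measure \<nu> by fact
  interpret \<mu>\<nu>: finite_measure "\<mu> \<Otimes>\<^sub>M \<nu>"
    by (rule finite_measure_pair_measure) fact+
  have fin: "finite_measure (\<alpha> k)" "finite_measure (\<beta> k)" "finite_measure \<alpha>'" "finite_measure \<beta>'" for k
    using finite_measure_le_measure \<alpha> \<beta> \<alpha>' \<beta>' assms(1,2) by metis+
  have sets: "sets (\<alpha> k \<Otimes>\<^sub>M \<beta> k) = sets (\<mu> \<Otimes>\<^sub>M \<nu>)" "sets (\<alpha>' \<Otimes>\<^sub>M \<beta>') = sets (\<mu> \<Otimes>\<^sub>M \<nu>)" for k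
    by (intro sets_pair_measure_cong \<alpha> \<beta> \<alpha>' \<beta>')+
  have le: "\<alpha> k \<Otimes>\<^sub>M \<beta> k \<le> \<mu> \<Otimes>\<^sub>M \<nu>" "\<alpha>' \<Otimes>\<^sub>M \<beta>' \<le> \<mu> \<Otimes>\<^sub>M \<nu>" for k
    by (intro pair_measure_mono assms(1,2) \<alpha> \<beta> \<alpha>' \<beta>')+
  note finp = finite_measure_le_measure[OF \<mu>\<nu>.finite_measure_axioms sets(1) le(1)]
    finite_measure_le_measure[OF \<mu>\<nu>.finite_measure_axioms sets(2) le(2)]
  have rect: "measure (M \<Otimes>\<^sub>M N) (A \<times> B) = measure M A * measure N B"
    if "finite_measure M" "finite_measure N" "A \<in> sets M" "B \<in> sets N"
    for M :: "'a measure" and N :: "'b measure" and A B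
    using sigma_finite_measure.emeasure_pair_measure_Times[OF finite_measure.axioms(1)[OF that(2)] that(3,4)]
    by (simp add: measure_def enn2real_mult)
  have box: "((\<lambda>k. measure (\<alpha> k \<Otimes>\<^sub>M \<beta> k) (A \<times> B)) \<longlongrightarrow> measure (\<alpha>' \<Otimes>\<^sub>M \<beta>') (A \<times> B)) F"
    if "A \<in> sets \<mu>" "B \<in> sets \<nu>" for A B
    using tendsto_mult[OF lim(1)[OF that(1)] lim(2)[OF that(2)]] that
    by (simp add: rect fin \<alpha> \<beta> \<alpha>' \<beta>')
  let ?E = "{A \<times> B | A B. A \<in> sets \<mu> \<and> B \<in> sets \<nu>}"
  have "S \<in> sigma_sets (space \<mu> \<times> space \<nu>) ?E"
    using S by (simp add: sets_pair_measure)
  with Int_stable_pair_measure_generator[of \<mu> \<nu>] pair_measure_closed[of \<mu> \<nu>]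
  show ?thesis
  proof (induction rule: sigma_sets_induct_disjoint)
    case (basic A)
    then show ?case using box by auto
  next
    case empty
    show ?case by simp
  next
    case (compl A)
    then have A: "A \<in> sets (\<mu> \<Otimes>\<^sub>M \<nu>)" by (simp add: sets_pair_measure)
    have "measure \<gamma> (space \<mu> \<times> space \<nu> - A) = measure \<gamma> (space \<mu> \<times> space \<nu>) - measure \<gamma> A"
      if "finite_measure \<gamma>" "sets \<gamma> = sets (\<mu> \<Otimes>\<^sub>M \<nu>)" for \<gamma>
      using finite_measure.finite_measure_compl[OF that(1), of A] A that(2)
        sets_eq_imp_space_eq[OF that(2)] by (simp add: space_pair_measure)
    with box[OF sets.top sets.top] compl(2) show ?case
      using finp sets by (auto intro!: tendsto_diff)
  next
    case (union A)
    then have A: "range A \<subseteq> sets (\<mu> \<Otimes>\<^sub>M \<nu>)" by (simp add: sets_pair_measure)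
    have "(\<Sum>m. measure (\<alpha>' \<Otimes>\<^sub>M \<beta>') (A m)) = measure (\<alpha>' \<Otimes>\<^sub>M \<beta>') (\<Union>m. A m)"
      using finite_measure.finite_measure_UNION[OF finp(2), of A] A union sets by (simp add: sums_iff)
    with dominated_measure_UNION_tendsto(2)[OF \<mu>\<nu>.finite_measure_axioms sets(1) le(1) assms(3)
        A union(1) union(3)]
    show ?case by simp
  qed
qed

section \<open>Plans and their slices\<close>

(* Keeps the simplifier from turning the index set {1..n} into {Suc 0..n}. *)
declare One_nat_def [simp del]

text \<open>The couplings of \<open>\<xi>\<close> with all probability measures on \<open>[n]\<close> at once; the second marginal is left
free because the quantization problem minimizes over it.\<close>

definition plans :: "'a measure \<Rightarrow> nat \<Rightarrow> ('a \<times> nat) measure set" where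
  "plans \<xi> n = {\<pi>. sets \<pi> = sets (\<xi> \<Otimes>\<^sub>M count_space {1..n}) \<and> distr \<pi> \<xi> fst = \<xi>}"

lemma sets_plan: "\<pi> \<in> plans \<xi> n \<Longrightarrow> sets \<pi> = sets (\<xi> \<Otimes>\<^sub>M count_space {1..n})"
  and distr_fst_plan: "\<pi> \<in> plans \<xi> n \<Longrightarrow> distr \<pi> \<xi> fst = \<xi>"
  by (simp_all add: plans_def)

lemma space_plan: "\<pi> \<in> plans \<xi> n \<Longrightarrow> space \<pi> = space \<xi> \<times> {1..n}"
  using sets_eq_imp_space_eq[OF sets_plan] by (metis space_count_space space_pair_measure)

lemma measurable_plan: "\<pi> \<in> plans \<xi> n \<Longrightarrow> measurable \<pi> N = measurable (\<xi> \<Otimes>\<^sub>M count_space {1..n}) N"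
  by (intro measurable_cong_sets sets_plan refl)

lemma sets_slice [simp]: "sets (slice \<xi> \<pi> i) = sets \<xi>"
  and space_slice [simp]: "space (slice \<xi> \<pi> i) = space \<xi>"
  by (simp_all add: slice_def)

lemma measurable_slice [simp]: "measurable (slice \<xi> \<pi> i) N = measurable \<xi> N"
  by (intro measurable_cong_sets) simp_all

lemma emeasure_slice_plan:
  "\<pi> \<in> plans \<xi> n \<Longrightarrow> i \<in> {1..n} \<Longrightarrow> A \<in> sets \<xi> \<Longrightarrow>
    emeasure (slice \<xi> \<pi> i) A = emeasure \<pi> (A \<times> {i})"
  by (rule emeasure_slice[OF sets_plan]) auto

lemma plan_prob_space:
  assumes "prob_space \<xi>" "\<pi> \<in> plans \<xi> n"
  shows "prob_space \<pi>"
proof (rule prob_space_distrD)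
  show "fst \<in> measurable \<pi> \<xi>" using assms(2) by (simp add: measurable_plan)
  show "prob_space (distr \<pi> \<xi> fst)" using assms by (simp add: distr_fst_plan)
qed

lemma emeasure_plan_fst:
  assumes "\<pi> \<in> plans \<xi> n" "A \<in> sets \<xi>"
  shows "emeasure \<pi> (A \<times> {1..n}) = emeasure \<xi> A"
proof -
  have "emeasure \<xi> A = emeasure (distr \<pi> \<xi> fst) A"
    using assms by (simp add: distr_fst_plan)
  also have "\<dots> = emeasure \<pi> (fst -` A \<inter> space \<pi>)"
    using assms by (intro emeasure_distr) (simp_all add: measurable_plan)
  also have "fst -` A \<inter> space \<pi> = A \<times> {1..n}"
    using sets.sets_into_space[OF assms(2)] by (auto simp: space_plan[OF assms(1)])
  finally show ?thesis by simp
qed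

lemma nn_integral_plan_fst:
  assumes "\<pi> \<in> plans \<xi> n" "f \<in> borel_measurable \<xi>"
  shows "(\<integral>\<^sup>+z. f (fst z) \<partial>\<pi>) = (\<integral>\<^sup>+x. f x \<partial>\<xi>)"
proof -
  have "(\<integral>\<^sup>+x. f x \<partial>\<xi>) = (\<integral>\<^sup>+x. f x \<partial>distr \<pi> \<xi> fst)"
    using assms(1) by (simp add: distr_fst_plan)
  also have "\<dots> = (\<integral>\<^sup>+z. f (fst z) \<partial>\<pi>)"
    using assms by (intro nn_integral_distr) (simp_all add: measurable_plan)
  finally show ?thesis by simp
qed

lemma slice_le:
  assumes "\<pi> \<in> plans \<xi> n" "i \<in> {1..n}"
  shows "slice \<xi> \<pi> i \<le> \<xi>"
proof -
  have "emeasure (slice \<xi> \<pi> i) A \<le> emeasure \<xi> A" if A: "A \<in> sets \<xi>" for A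
  proof -
    have "emeasure \<pi> (A \<times> {i}) \<le> emeasure \<pi> (A \<times> {1..n})"
      using assms A by (intro emeasure_mono) (auto simp: sets_plan)
    then show ?thesis
      unfolding emeasure_slice_plan[OF assms A] emeasure_plan_fst[OF assms(1) A] .
  qed
  then show ?thesis by (simp add: le_measure)
qed

lemma finite_measure_slice:
  assumes "prob_space \<xi>" "\<pi> \<in> plans \<xi> n" "i \<in> {1..n}"
  shows "finite_measure (slice \<xi> \<pi> i)"
  by (rule finite_measure_le_measure[OF prob_space.finite_measure[OF assms(1)] sets_slice
        slice_le[OF assms(2,3)]])

text \<open>This form of the slice gives access to the change of variables and density formulas for integrals.\<close>

lemma slice_eq_distr_density:
  assumes "\<pi> \<in> plans \<xi> n" "i \<in> {1..n}"
  shows "slice \<xi> \<pi> i = distr (density \<pi> (indicator (space \<xi> \<times> {i}))) \<xi> fst"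
proof (rule measure_eqI)
  fix A assume "A \<in> sets (slice \<xi> \<pi> i)"
  then have A: "A \<in> sets \<xi>" by simp
  have S: "space \<xi> \<times> {i} \<in> sets \<pi>" using assms by (auto simp: sets_plan)
  have *: "fst -` A \<inter> space \<pi> \<in> sets \<pi>" "fst \<in> measurable \<pi> \<xi>"
    using measurable_sets[of fst \<pi> \<xi> A] A assms by (simp_all add: measurable_plan)
  have "emeasure (distr (density \<pi> (indicator (space \<xi> \<times> {i}))) \<xi> fst) A
    = emeasure (density \<pi> (indicator (space \<xi> \<times> {i}))) (fst -` A \<inter> space \<pi>)"
    using * A by (subst emeasure_distr) simp_all
  also have "\<dots> = emeasure \<pi> ((space \<xi> \<times> {i}) \<inter> (fst -` A \<inter> space \<pi>))"
    using S * by (subst emeasure_density) (auto simp: indicator_inter_arith[symmetric])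
  also have "(space \<xi> \<times> {i}) \<inter> (fst -` A \<inter> space \<pi>) = A \<times> {i}"
    using sets.sets_into_space[OF A] assms by (auto simp: space_plan)
  finally show "emeasure (slice \<xi> \<pi> i) A
      = emeasure (distr (density \<pi> (indicator (space \<xi> \<times> {i}))) \<xi> fst) A"
    using assms A by (simp add: emeasure_slice_plan)
qed simp

lemma nn_integral_slice:
  assumes "\<pi> \<in> plans \<xi> n" "i \<in> {1..n}" "f \<in> borel_measurable \<xi>"
  shows "(\<integral>\<^sup>+x. f x \<partial>slice \<xi> \<pi> i) = (\<integral>\<^sup>+z. indicator (space \<xi> \<times> {i}) z * f (fst z) \<partial>\<pi>)"
proof -
  have S: "space \<xi> \<times> {i} \<in> sets \<pi>" using assms by (auto simp: sets_plan)
  have fst: "fst \<in> measurable \<pi> \<xi>" using assms by (simp add: measurable_plan)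
  have "(\<integral>\<^sup>+x. f x \<partial>slice \<xi> \<pi> i) = (\<integral>\<^sup>+z. f (fst z) \<partial>density \<pi> (indicator (space \<xi> \<times> {i})))"
    using assms fst by (simp add: slice_eq_distr_density nn_integral_distr)
  also have "\<dots> = (\<integral>\<^sup>+z. indicator (space \<xi> \<times> {i}) z * f (fst z) \<partial>\<pi>)"
    using S measurable_compose[OF fst assms(3)] by (intro nn_integral_density) auto
  finally show ?thesis .
qed

lemma nn_integral_plan:
  assumes \<pi>: "\<pi> \<in> plans \<xi> n" and f: "f \<in> borel_measurable (\<xi> \<Otimes>\<^sub>M count_space {1..n})"
  shows "(\<integral>\<^sup>+z. f z \<partial>\<pi>) = (\<Sum>i\<in>{1..n}. \<integral>\<^sup>+x. f (x, i) \<partial>slice \<xi> \<pi> i)"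
proof -
  have fst: "fst \<in> measurable \<pi> \<xi>" using \<pi> by (simp add: measurable_plan)
  have fi: "(\<lambda>x. f (x, i)) \<in> borel_measurable \<xi>" if "i \<in> {1..n}" for i
    using that by (intro measurable_compose[OF _ f]) auto
  have "(\<integral>\<^sup>+z. f z \<partial>\<pi>) = (\<integral>\<^sup>+z. (\<Sum>i\<in>{1..n}. indicator (space \<xi> \<times> {i}) z * f (fst z, i)) \<partial>\<pi>)"
  proof (rule nn_integral_cong)
    fix z assume "z \<in> space \<pi>"
    then obtain x j where z: "z = (x, j)" "x \<in> space \<xi>" "j \<in> {1..n}"
      using \<pi> by (auto simp: space_plan)
    have "(\<Sum>i\<in>{1..n}. indicator (space \<xi> \<times> {i}) z * f (fst z, i))
      = (\<Sum>i\<in>{1..n}. if i = j then f (x, i) else 0)"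
      using z by (intro sum.cong) (auto simp: indicator_def)
    then show "f z = (\<Sum>i\<in>{1..n}. indicator (space \<xi> \<times> {i}) z * f (fst z, i))"
      using z by simp
  qed
  also have "\<dots> = (\<Sum>i\<in>{1..n}. \<integral>\<^sup>+z. indicator (space \<xi> \<times> {i}) z * f (fst z, i) \<partial>\<pi>)"
  proof (rule nn_integral_sum)
    fix i assume i: "i \<in> {1..n}"
    then have "space \<xi> \<times> {i} \<in> sets \<pi>" using \<pi> by (auto simp: sets_plan)
    with measurable_compose[OF fst fi[OF i]]
    show "(\<lambda>z. indicator (space \<xi> \<times> {i}) z * f (fst z, i)) \<in> borel_measurable \<pi>"
      by auto
  qed
  also have "\<dots> = (\<Sum>i\<in>{1..n}. \<integral>\<^sup>+x. f (x, i) \<partial>slice \<xi> \<pi> i)"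
    using \<pi> fi by (intro sum.cong refl nn_integral_slice[symmetric]) auto
  finally show ?thesis .
qed

text \<open>Disintegration of a product of plans into products of slices; it turns the cost of a coupling into a
double sum over the indices.\<close>

lemma nn_integral_plan_pair:
  assumes \<xi>: "prob_space \<xi>" and \<pi>: "\<pi> \<in> plans \<xi> n" and \<rho>: "\<rho> \<in> plans \<xi> n"
    and F: "F \<in> borel_measurable ((\<xi> \<Otimes>\<^sub>M count_space {1..n}) \<Otimes>\<^sub>M (\<xi> \<Otimes>\<^sub>M count_space {1..n}))"
  shows "(\<integral>\<^sup>+p. F p \<partial>(\<pi> \<Otimes>\<^sub>M \<rho>)) = (\<Sum>i\<in>{1..n}. \<Sum>j\<in>{1..n}.
    \<integral>\<^sup>+p. F ((fst p, i), (snd p, j)) \<partial>(slice \<xi> \<pi> i \<Otimes>\<^sub>M slice \<xi> \<rho> j))"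
proof -
  interpret \<rho>: prob_space \<rho> by (rule plan_prob_space[OF \<xi> \<rho>])
  have F': "F \<in> borel_measurable (\<pi> \<Otimes>\<^sub>M \<rho>)"
    using F by (simp cong: measurable_cong_sets add: sets_plan[OF \<pi>] sets_plan[OF \<rho>] sets_pair_measure_cong[OF sets_plan[OF \<pi>] sets_plan[OF \<rho>]])
  have inner: "(\<lambda>z. \<integral>\<^sup>+w. F (z, w) \<partial>\<rho>) \<in> borel_measurable (\<xi> \<Otimes>\<^sub>M count_space {1..n})"
    using \<rho>.borel_measurable_nn_integral_fst[OF F'] by (simp add: measurable_plan[OF \<pi>])
  have "(\<integral>\<^sup>+p. F p \<partial>(\<pi> \<Otimes>\<^sub>M \<rho>)) = (\<integral>\<^sup>+z. \<integral>\<^sup>+w. F (z, w) \<partial>\<rho> \<partial>\<pi>)"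
    by (rule \<rho>.nn_integral_fst[OF F', symmetric])
  also have "\<dots> = (\<Sum>i\<in>{1..n}. \<integral>\<^sup>+x. \<integral>\<^sup>+w. F ((x, i), w) \<partial>\<rho> \<partial>slice \<xi> \<pi> i)"
    by (rule nn_integral_plan[OF \<pi> inner])
  also have "\<dots> = (\<Sum>i\<in>{1..n}. \<Sum>j\<in>{1..n}.
    \<integral>\<^sup>+p. F ((fst p, i), (snd p, j)) \<partial>(slice \<xi> \<pi> i \<Otimes>\<^sub>M slice \<xi> \<rho> j))"
  proof (rule sum.cong[OF refl])
    fix i assume i: "i \<in> {1..n}"
    have Fij: "(\<lambda>p. F ((fst p, i), (snd p, j))) \<in> borel_measurable (\<xi> \<Otimes>\<^sub>M \<xi>)" if "j \<in> {1..n}" for j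
      using i that by (intro measurable_compose[OF _ F]) auto
    have Fij': "(\<lambda>p. F ((fst p, i), (snd p, j))) \<in> borel_measurable (slice \<xi> \<pi> i \<Otimes>\<^sub>M slice \<xi> \<rho> j)"
      if "j \<in> {1..n}" for j
      using Fij[OF that] by (simp cong: measurable_cong_sets add: sets_pair_measure_cong[of "slice \<xi> \<pi> i" \<xi> "slice \<xi> \<rho> j" \<xi>])
    have s: "sigma_finite_measure (slice \<xi> \<rho> j)" if "j \<in> {1..n}" for j
      by (rule finite_measure.axioms(1)[OF finite_measure_slice[OF \<xi> \<rho> that]])
    have "(\<integral>\<^sup>+x. \<integral>\<^sup>+w. F ((x, i), w) \<partial>\<rho> \<partial>slice \<xi> \<pi> i)
      = (\<integral>\<^sup>+x. (\<Sum>j\<in>{1..n}. \<integral>\<^sup>+x'. F ((x, i), (x', j)) \<partial>slice \<xi> \<rho> j) \<partial>slice \<xi> \<pi> i)"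
    proof (rule nn_integral_cong)
      fix x assume "x \<in> space (slice \<xi> \<pi> i)"
      then have "(x, i) \<in> space (\<xi> \<Otimes>\<^sub>M count_space {1..n})"
        using i by (simp add: space_pair_measure)
      then show "(\<integral>\<^sup>+w. F ((x, i), w) \<partial>\<rho>) = (\<Sum>j\<in>{1..n}. \<integral>\<^sup>+x'. F ((x, i), (x', j)) \<partial>slice \<xi> \<rho> j)"
        by (intro nn_integral_plan[OF \<rho>] measurable_compose[OF _ F]) auto
    qed
    also have "\<dots> = (\<Sum>j\<in>{1..n}. \<integral>\<^sup>+x. \<integral>\<^sup>+x'. F ((x, i), (x', j)) \<partial>slice \<xi> \<rho> j \<partial>slice \<xi> \<pi> i)"
    proof (rule nn_integral_sum)
      fix j assume j: "j \<in> {1..n}"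
      show "(\<lambda>x. \<integral>\<^sup>+x'. F ((x, i), (x', j)) \<partial>slice \<xi> \<rho> j) \<in> borel_measurable (slice \<xi> \<pi> i)"
        using sigma_finite_measure.borel_measurable_nn_integral_fst[OF s[OF j] Fij'[OF j]] by simp
    qed
    also have "\<dots> = (\<Sum>j\<in>{1..n}. \<integral>\<^sup>+p. F ((fst p, i), (snd p, j)) \<partial>(slice \<xi> \<pi> i \<Otimes>\<^sub>M slice \<xi> \<rho> j))"
    proof (rule sum.cong[OF refl])
      fix j assume j: "j \<in> {1..n}"
      show "(\<integral>\<^sup>+x. \<integral>\<^sup>+x'. F ((x, i), (x', j)) \<partial>slice \<xi> \<rho> j \<partial>slice \<xi> \<pi> i)
        = (\<integral>\<^sup>+p. F ((fst p, i), (snd p, j)) \<partial>(slice \<xi> \<pi> i \<Otimes>\<^sub>M slice \<xi> \<rho> j))"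
        using sigma_finite_measure.nn_integral_fst[OF s[OF j] Fij'[OF j]] by simp
    qed
    finally show "(\<integral>\<^sup>+x. \<integral>\<^sup>+w. F ((x, i), w) \<partial>\<rho> \<partial>slice \<xi> \<pi> i) = \<dots>" .
  qed
  finally show ?thesis .
qed

lemma coupling_is_plan:
  assumes "sets \<upsilon> = Pow {1..n}" "\<pi> \<in> couplings \<xi> \<upsilon>"
  shows "\<pi> \<in> plans \<xi> n"
proof -
  have "sets (\<xi> \<Otimes>\<^sub>M \<upsilon>) = sets (\<xi> \<Otimes>\<^sub>M count_space {1..n})"
    using assms by (intro sets_pair_measure_cong) simp_all
  then show ?thesis using assms by (simp add: couplings_def plans_def)
qed

lemma plan_is_coupling:
  assumes "prob_space \<xi>" "\<pi> \<in> plans \<xi> n"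
  defines "\<upsilon> \<equiv> distr \<pi> (count_space {1..n}) snd"
  shows "prob_space \<upsilon>" "\<pi> \<in> couplings \<xi> \<upsilon>"
proof -
  interpret prob_space \<pi> by (rule plan_prob_space) fact+
  have snd: "snd \<in> measurable \<pi> (count_space {1..n})"
    using assms by (simp add: measurable_plan)
  show "prob_space \<upsilon>" unfolding \<upsilon>_def by (rule prob_space_distr[OF snd])
  have "sets \<pi> = sets (\<xi> \<Otimes>\<^sub>M \<upsilon>)"
    unfolding sets_plan[OF assms(2)] \<upsilon>_def by (intro sets_pair_measure_cong) simp_all
  moreover have "distr \<pi> \<upsilon> snd = \<upsilon>"
    unfolding \<upsilon>_def by (intro distr_cong) simp_all
  ultimately show "\<pi> \<in> couplings \<xi> \<upsilon>"
    using prob_space_axioms distr_fst_plan[OF assms(2)] by (simp add: couplings_def)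
qed

lemma measure_slice_space:
  fixes n :: nat
  assumes "sets \<upsilon> = Pow {1..n}" "\<pi> \<in> couplings \<xi> \<upsilon>" "i \<in> {1..n}"
  shows "measure (slice \<xi> \<pi> i) (space \<xi>) = measure \<upsilon> {i}"
proof -
  have \<pi>: "\<pi> \<in> plans \<xi> n" by (rule coupling_is_plan) fact+
  have snd: "snd \<in> measurable \<pi> \<upsilon>"
    using measurable_cong_sets[OF refl, of \<upsilon> "count_space {1..n}" \<pi>] assms(1) \<pi>
    by (simp add: measurable_plan)
  have "measure \<upsilon> {i} = measure (distr \<pi> \<upsilon> snd) {i}"
    using assms by (simp add: couplings_def)
  also have "\<dots> = measure \<pi> (snd -` {i} \<inter> space \<pi>)"
    using snd assms by (intro measure_distr) auto
  also have "snd -` {i} \<inter> space \<pi> = space \<xi> \<times> {i}"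
    using assms(3) \<pi> by (auto simp: space_plan)
  finally show ?thesis
    using emeasure_slice_plan[OF \<pi> assms(3) sets.top] by (simp add: measure_def)
qed

text \<open>The common majorant that makes the set of plans compact: each of the \<open>n\<close> slices is at most \<open>\<xi>\<close>.\<close>

lemma plan_le:
  assumes \<xi>: "prob_space \<xi>" and \<pi>: "\<pi> \<in> plans \<xi> n"
  shows "\<pi> \<le> \<xi> \<Otimes>\<^sub>M count_space {1..n}"
proof -
  interpret \<xi>: prob_space \<xi> by fact
  interpret c: finite_measure "count_space {1..n}" by (rule finite_measure_count_space) simp
  interpret P: pair_sigma_finite \<xi> "count_space {1..n}" ..
  have "emeasure \<pi> S \<le> emeasure (\<xi> \<Otimes>\<^sub>M count_space {1..n}) S"
    if S: "S \<in> sets (\<xi> \<Otimes>\<^sub>M count_space {1..n})" for S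
  proof -
    have "emeasure \<pi> S = (\<integral>\<^sup>+z. indicator S z \<partial>\<pi>)"
      using S \<pi> by (simp add: sets_plan)
    also have "\<dots> = (\<Sum>i\<in>{1..n}. \<integral>\<^sup>+x. indicator S (x, i) \<partial>slice \<xi> \<pi> i)"
      using S by (intro nn_integral_plan[OF \<pi>]) simp
    also have "\<dots> \<le> (\<Sum>i\<in>{1..n}. \<integral>\<^sup>+x. indicator S (x, i) \<partial>\<xi>)"
      by (intro sum_mono nn_integral_mono_measure sets_slice slice_le[OF \<pi>])
    also have "\<dots> = (\<integral>\<^sup>+i. \<integral>\<^sup>+x. indicator S (x, i) \<partial>\<xi> \<partial>count_space {1..n})"
      by (rule nn_integral_count_space_finite[symmetric]) simp
    also have "\<dots> = emeasure (\<xi> \<Otimes>\<^sub>M count_space {1..n}) S"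
      using P.nn_integral_snd[of "indicator S"] S by simp
    finally show ?thesis .
  qed
  then show ?thesis using \<pi> by (simp add: le_measure sets_plan)
qed

lemma graph_plan:
  assumes "T \<in> measurable \<xi> (count_space {1..n})"
  shows "distr \<xi> (\<xi> \<Otimes>\<^sub>M count_space {1..n}) (\<lambda>x. (x, T x)) \<in> plans \<xi> n"
proof -
  have "distr (distr \<xi> (\<xi> \<Otimes>\<^sub>M count_space {1..n}) (\<lambda>x. (x, T x))) \<xi> fst = distr \<xi> \<xi> (\<lambda>x. x)"
    using assms by (simp add: distr_distr comp_def)
  also have "\<dots> = \<xi>" by (rule distr_id)
  finally show ?thesis by (simp add: plans_def)
qed

text \<open>The first marginal survives the limit, since it is tested on the sets \<open>A \<times> {1..n}\<close>, where all plans
of the sequence agree.\<close>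

lemma plans_cluster:
  fixes \<pi> :: "nat \<Rightarrow> ('a \<times> nat) measure"
  assumes \<xi>: "prob_space \<xi>" and \<pi>: "\<And>k. \<pi> k \<in> plans \<xi> n"
  obtains F \<rho> where "F \<noteq> bot" "F \<le> sequentially" "\<rho> \<in> plans \<xi> n"
    "\<And>i A. i \<in> {1..n} \<Longrightarrow> A \<in> sets \<xi> \<Longrightarrow>
      ((\<lambda>k. measure (slice \<xi> (\<pi> k) i) A) \<longlongrightarrow> measure (slice \<xi> \<rho> i) A) F"
proof -
  interpret \<xi>: prob_space \<xi> by fact
  have "finite_measure (\<xi> \<Otimes>\<^sub>M count_space {1..n})"
    by (rule finite_measure_pair_measure[OF finite_measure_count_space \<xi>.finite_measure_axioms]) simp
  obtain F \<rho> where F: "F \<noteq> bot" "F \<le> sequentially"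
    and \<rho>: "sets \<rho> = sets (\<xi> \<Otimes>\<^sub>M count_space {1..n})" "\<rho> \<le> \<xi> \<Otimes>\<^sub>M count_space {1..n}"
    and lim: "\<And>A. A \<in> sets (\<xi> \<Otimes>\<^sub>M count_space {1..n}) \<Longrightarrow>
      ((\<lambda>k. measure (\<pi> k) A) \<longlongrightarrow> measure \<rho> A) F"
    using setwise_cluster_measure[of _ \<pi>, OF \<open>finite_measure _\<close> sets_plan[OF \<pi>] plan_le[OF \<xi> \<pi>]]
    by metis
  interpret \<rho>: finite_measure \<rho> by (rule finite_measure_le_measure[OF \<open>finite_measure _\<close> \<rho>])
  have "distr \<rho> \<xi> fst = \<xi>"
  proof (rule measure_eqI)
    fix A assume "A \<in> sets (distr \<rho> \<xi> fst)"
    then have A: "A \<in> sets \<xi>" by simp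
    then have A': "A \<times> {1..n} \<in> sets (\<xi> \<Otimes>\<^sub>M count_space {1..n})" by auto
    have "((\<lambda>k. measure (\<pi> k) (A \<times> {1..n})) \<longlongrightarrow> measure \<rho> (A \<times> {1..n})) F"
      by (rule lim[OF A'])
    moreover have "measure (\<pi> k) (A \<times> {1..n}) = measure \<xi> A" for k
      unfolding measure_def emeasure_plan_fst[OF \<pi> A] ..
    ultimately have eq: "measure \<rho> (A \<times> {1..n}) = measure \<xi> A"
      using tendsto_unique[OF F(1) _ tendsto_const] by simp
    have fst: "fst \<in> measurable \<rho> \<xi>"
      by (simp add: measurable_cong_sets[OF \<rho>(1) refl])
    have "space \<rho> = space \<xi> \<times> {1..n}"
      using sets_eq_imp_space_eq[OF \<rho>(1)] by (simp add: space_pair_measure)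
    then have "fst -` A \<inter> space \<rho> = A \<times> {1..n}"
      using sets.sets_into_space[OF A] by auto
    then show "emeasure (distr \<rho> \<xi> fst) A = emeasure \<xi> A"
      unfolding emeasure_distr[OF fst A] using eq
      by (simp add: \<rho>.emeasure_eq_measure \<xi>.emeasure_eq_measure)
  qed simp
  with \<rho> have "\<rho> \<in> plans \<xi> n" by (simp add: plans_def)
  moreover have "((\<lambda>k. measure (slice \<xi> (\<pi> k) i) A) \<longlongrightarrow> measure (slice \<xi> \<rho> i) A) F"
    if "i \<in> {1..n}" "A \<in> sets \<xi>" for i A
  proof -
    have "measure (slice \<xi> \<sigma> i) A = measure \<sigma> (A \<times> {i})" if "\<sigma> \<in> plans \<xi> n" for \<sigma>
      unfolding measure_def emeasure_slice_plan[OF that \<open>i \<in> {1..n}\<close> \<open>A \<in> sets \<xi>\<close>] ..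
    with \<open>\<rho> \<in> plans \<xi> n\<close> \<pi> show ?thesis
      using lim[of "A \<times> {i}"] that by auto
  qed
  ultimately show thesis using that F by blast
qed

text \<open>The convex combination \<open>(1 - t) \<pi> + t \<rho>\<close>, which is needed as an admissible direction of variation.\<close>

lemma mixture_plan:
  assumes \<xi>: "prob_space \<xi>" and \<pi>: "\<pi> \<in> plans \<xi> n" and \<rho>: "\<rho> \<in> plans \<xi> n" and t: "0 \<le> t" "t \<le> 1"
  obtains \<sigma> where "\<sigma> \<in> plans \<xi> n"
    "\<And>f. f \<in> borel_measurable (\<xi> \<Otimes>\<^sub>M count_space {1..n}) \<Longrightarrow>
      (\<integral>\<^sup>+z. f z \<partial>\<sigma>) = ennreal (1 - t) * (\<integral>\<^sup>+z. f z \<partial>\<pi>) + ennreal t * (\<integral>\<^sup>+z. f z \<partial>\<rho>)"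
proof -
  let ?M = "\<xi> \<Otimes>\<^sub>M count_space {1..n}"
  \<comment> \<open>Toss a coin with bias \<open>t\<close> and draw from \<open>\<rho>\<close> or \<open>\<pi>\<close> accordingly.\<close>
  define \<sigma> where "\<sigma> = measure_pmf (bernoulli_pmf t) \<bind> (\<lambda>b. if b then \<rho> else \<pi>)"
  have kernel: "(\<lambda>b. if b then \<rho> else \<pi>) \<in> measurable (measure_pmf (bernoulli_pmf t)) (subprob_algebra ?M)"
    using plan_prob_space[OF \<xi> \<pi>] plan_prob_space[OF \<xi> \<rho>] sets_plan[OF \<pi>] sets_plan[OF \<rho>]
    by (auto simp: space_subprob_algebra prob_space_imp_subprob_space)
  have sets: "sets \<sigma> = sets ?M"
    unfolding \<sigma>_def using sets_plan[OF \<pi>] sets_plan[OF \<rho>] by (intro sets_bind) auto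
  have int: "(\<integral>\<^sup>+z. f z \<partial>\<sigma>) = ennreal (1 - t) * (\<integral>\<^sup>+z. f z \<partial>\<pi>) + ennreal t * (\<integral>\<^sup>+z. f z \<partial>\<rho>)"
    if "f \<in> borel_measurable ?M" for f
    unfolding \<sigma>_def nn_integral_bind[OF that kernel] using t by (simp add: ac_simps)
  have "distr \<sigma> \<xi> fst = \<xi>"
  proof (rule measure_eqI)
    fix A assume "A \<in> sets (distr \<sigma> \<xi> fst)"
    then have A: "A \<in> sets \<xi>" by simp
    have fst: "fst \<in> measurable \<sigma> \<xi>" by (simp add: measurable_cong_sets[OF sets refl])
    have "emeasure (distr \<sigma> \<xi> fst) A = (\<integral>\<^sup>+x. indicator A x \<partial>distr \<sigma> \<xi> fst)"
      using A by simp
    also have "\<dots> = (\<integral>\<^sup>+z. indicator A (fst z) \<partial>\<sigma>)"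
      using A fst by (intro nn_integral_distr) simp_all
    also have "\<dots> = ennreal (1 - t) * (\<integral>\<^sup>+z. indicator A (fst z) \<partial>\<pi>) + ennreal t * (\<integral>\<^sup>+z. indicator A (fst z) \<partial>\<rho>)"
      using A by (intro int) simp
    also have "\<dots> = ennreal (1 - t) * emeasure \<xi> A + ennreal t * emeasure \<xi> A"
      using A nn_integral_plan_fst[OF \<pi>, of "indicator A"] nn_integral_plan_fst[OF \<rho>, of "indicator A"]
      by simp
    also have "\<dots> = ennreal (1 - t + t) * emeasure \<xi> A"
      using t by (subst ennreal_plus) (auto simp: distrib_right)
    finally show "emeasure (distr \<sigma> \<xi> fst) A = emeasure \<xi> A" by simp
  qed simp
  with sets int show thesis by (intro that[of \<sigma>]) (auto simp: plans_def)
qed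

lemma plan_eq_graph:
  assumes \<pi>: "\<pi> \<in> plans \<xi> n" and T: "T \<in> measurable \<xi> (count_space {1..n})"
    and AE: "AE z in \<pi>. snd z = T (fst z)"
  shows "\<pi> = distr \<xi> (\<xi> \<Otimes>\<^sub>M count_space {1..n}) (\<lambda>x. (x, T x))"
proof -
  let ?M = "\<xi> \<Otimes>\<^sub>M count_space {1..n}"
  have fst: "fst \<in> measurable \<pi> \<xi>" by (simp add: measurable_plan[OF \<pi>])
  have graph: "(\<lambda>x. (x, T x)) \<in> measurable \<xi> ?M" using T by simp
  have "\<pi> = distr \<pi> ?M (\<lambda>z. z)"
    using sets_plan[OF \<pi>] by (simp add: distr_id2)
  also have "\<dots> = distr \<pi> ?M (\<lambda>z. (fst z, T (fst z)))"
  proof (rule distr_cong_AE)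
    show "AE z in \<pi>. z = (fst z, T (fst z))"
      using AE by eventually_elim (simp add: prod_eq_iff)
    show "(\<lambda>z. (fst z, T (fst z))) \<in> measurable \<pi> ?M"
      by (rule measurable_compose[OF fst graph])
  qed (simp_all add: measurable_plan[OF \<pi>])
  also have "\<dots> = distr (distr \<pi> \<xi> fst) ?M (\<lambda>x. (x, T x))"
    by (simp add: distr_distr[OF graph fst] comp_def)
  also have "distr \<pi> \<xi> fst = \<xi>" by (rule distr_fst_plan[OF \<pi>])
  finally show ?thesis .
qed

lemma slice_graph:
  fixes n :: nat
  assumes T: "T \<in> measurable \<xi> (count_space {1..n})" and i: "i \<in> {1..n}"
  shows "slice \<xi> (distr \<xi> (\<xi> \<Otimes>\<^sub>M count_space {1..n}) (\<lambda>x. (x, T x))) i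
    = density \<xi> (indicator {x \<in> space \<xi>. T x = i})"
proof (rule measure_eqI)
  let ?V = "{x \<in> space \<xi>. T x = i}"
  fix A assume "A \<in> sets (slice \<xi> (distr \<xi> (\<xi> \<Otimes>\<^sub>M count_space {1..n}) (\<lambda>x. (x, T x))) i)"
  then have A: "A \<in> sets \<xi>" by simp
  have "?V = T -` {i} \<inter> space \<xi>" by auto
  then have V: "?V \<in> sets \<xi>" using measurable_sets[OF T, of "{i}"] i by simp
  have "emeasure (slice \<xi> (distr \<xi> (\<xi> \<Otimes>\<^sub>M count_space {1..n}) (\<lambda>x. (x, T x))) i) A
    = emeasure \<xi> ((\<lambda>x. (x, T x)) -` (A \<times> {i}) \<inter> space \<xi>)"
    unfolding emeasure_slice_plan[OF graph_plan[OF T] i A] using T A i by (intro emeasure_distr) auto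
  also have "(\<lambda>x. (x, T x)) -` (A \<times> {i}) \<inter> space \<xi> = ?V \<inter> A" by auto
  also have "emeasure \<xi> (?V \<inter> A) = emeasure (density \<xi> (indicator ?V)) A"
    using V A by (subst emeasure_density) (auto simp: indicator_inter_arith[symmetric])
  finally show "emeasure (slice \<xi> (distr \<xi> (\<xi> \<Otimes>\<^sub>M count_space {1..n}) (\<lambda>x. (x, T x))) i) A
      = emeasure (density \<xi> (indicator ?V)) A" .
qed simp

section \<open>Voronoi partitions\<close>

lemma voronoi_index_in:
  assumes "1 \<le> n"
  shows "voronoi_index n c x \<in> {1..n}" "c (voronoi_index n c x) x = (MIN j\<in>{1..n}. c j x)"
proof -
  have "(MIN j\<in>{1..n}. c j x) \<in> (\<lambda>j. c j x) ` {1..n}"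
    using assms by (intro Min_in) auto
  then have "{i \<in> {1..n}. c i x = (MIN j\<in>{1..n}. c j x)} \<noteq> {}" by auto
  from Min_in[OF _ this] show "voronoi_index n c x \<in> {1..n}"
    "c (voronoi_index n c x) x = (MIN j\<in>{1..n}. c j x)"
    by (auto simp: voronoi_index_def)
qed

text \<open>The tie-breaking rule, in a form that exhibits the cells as Boolean combinations of the sets on which
one cost attains the minimum; measurability of the index follows.\<close>

lemma voronoi_index_eq_iff:
  assumes "i \<in> {1..n}"
  shows "voronoi_index n c x = i \<longleftrightarrow>
    c i x = (MIN j\<in>{1..n}. c j x) \<and> (\<forall>k\<in>{1..<i}. c k x \<noteq> (MIN j\<in>{1..n}. c j x))"
proof -
  define S where "S = {i \<in> {1..n}. c i x = (MIN j\<in>{1..n}. c j x)}"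
  have S: "finite S" "S \<noteq> {}"
    using voronoi_index_in[of n c x] assms unfolding S_def by auto
  have "voronoi_index n c x = i \<longleftrightarrow> i \<in> S \<and> (\<forall>k\<in>S. i \<le> k)"
    unfolding voronoi_index_def S_def[symmetric] by (rule Min_eq_iff[OF S])
  also have "\<dots> \<longleftrightarrow> i \<in> S \<and> (\<forall>k\<in>{1..<i}. k \<notin> S)"
    using assms by (force simp: S_def not_le)
  also have "\<dots> \<longleftrightarrow> c i x = (MIN j\<in>{1..n}. c j x) \<and> (\<forall>k\<in>{1..<i}. c k x \<noteq> (MIN j\<in>{1..n}. c j x))"
    using assms by (auto simp: S_def)
  finally show ?thesis .
qed

lemma min_cost_measurable:
  fixes c :: "nat \<Rightarrow> 'a \<Rightarrow> 'b :: {second_countable_topology, linorder_topology}"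
  assumes "\<And>i. i \<in> {1..n} \<Longrightarrow> c i \<in> borel_measurable M"
  shows "(\<lambda>x. MIN j\<in>{1..n}. c j x) \<in> borel_measurable M"
  using assms by (intro borel_measurable_Min) auto

lemma voronoi_index_measurable:
  fixes c :: "nat \<Rightarrow> 'a \<Rightarrow> 'b :: {second_countable_topology, linorder_topology}"
  assumes "1 \<le> n" and c: "\<And>i. i \<in> {1..n} \<Longrightarrow> c i \<in> borel_measurable M"
  shows "voronoi_index n c \<in> measurable M (count_space {1..n})"
proof (subst measurable_count_space_eq2)
  note m[measurable] = min_cost_measurable[OF c]
  have eq: "{x \<in> space M. c i x = (MIN j\<in>{1..n}. c j x)} \<in> sets M" if "i \<in> {1..n}" for i
  proof -
    have [measurable]: "c i \<in> borel_measurable M" by (rule c[OF that])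
    show ?thesis by measurable
  qed
  have "voronoi_index n c -` {i} \<inter> space M \<in> sets M" if i: "i \<in> {1..n}" for i
  proof -
    have "voronoi_index n c -` {i} \<inter> space M
      = {x \<in> space M. c i x = (MIN j\<in>{1..n}. c j x)}
        - (\<Union>k\<in>{1..<i}. {x \<in> space M. c k x = (MIN j\<in>{1..n}. c j x)})"
      using voronoi_index_eq_iff[OF i, of c] by auto
    also have "\<dots> \<in> sets M"
      using i by (intro sets.Diff sets.finite_UN eq) auto
    finally show ?thesis .
  qed
  then show "voronoi_index n c \<in> space M \<rightarrow> {1..n} \<and> (\<forall>a\<in>{1..n}. voronoi_index n c -` {a} \<inter> space M \<in> sets M)"
    using voronoi_index_in(1)[OF assms(1), of c] by auto
qed simp

text \<open>Both the second coordinate and the Voronoi index attain the minimum at the first coordinate; almost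
everywhere only one index does.\<close>

lemma AE_snd_voronoi_index:
  fixes c :: "nat \<Rightarrow> 'a \<Rightarrow> 'b :: {second_countable_topology, linorder_topology}"
  assumes \<pi>: "\<pi> \<in> plans \<xi> n" and n: "1 \<le> n"
    and c: "\<And>i. i \<in> {1..n} \<Longrightarrow> c i \<in> borel_measurable \<xi>"
    and argmin: "AE z in \<pi>. c (snd z) (fst z) = (MIN j\<in>{1..n}. c j (fst z))"
    and disjoint: "\<And>i j. i \<in> {1..n} \<Longrightarrow> j \<in> {1..n} \<Longrightarrow> i \<noteq> j \<Longrightarrow>
      emeasure \<xi> {x \<in> space \<xi>. c i x = (MIN k\<in>{1..n}. c k x) \<and> c j x = (MIN k\<in>{1..n}. c k x)} = 0"
  shows "AE z in \<pi>. snd z = voronoi_index n c (fst z)"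
proof -
  let ?m = "\<lambda>x. MIN k\<in>{1..n}. c k x"
  have m[measurable]: "?m \<in> borel_measurable \<xi>" by (rule min_cost_measurable[OF c])
  have "AE x in \<xi>. \<not> (c i x = ?m x \<and> c j x = ?m x)" if "i \<in> {1..n}" "j \<in> {1..n}" "i \<noteq> j" for i j
  proof (rule AE_I')
    have [measurable]: "c i \<in> borel_measurable \<xi>" "c j \<in> borel_measurable \<xi>"
      using c that by auto
    have "{x \<in> space \<xi>. c i x = ?m x \<and> c j x = ?m x} \<in> sets \<xi>" by measurable
    then show "{x \<in> space \<xi>. c i x = ?m x \<and> c j x = ?m x} \<in> null_sets \<xi>"
      using disjoint[OF that] by (simp add: null_sets_def)
  qed auto
  then have "AE x in \<xi>. \<forall>i\<in>{1..n}. \<forall>j\<in>{1..n}. i \<noteq> j \<longrightarrow> \<not> (c i x = ?m x \<and> c j x = ?m x)"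
    by (intro AE_finite_allI) auto
  then have "AE x in distr \<pi> \<xi> fst. \<forall>i\<in>{1..n}. \<forall>j\<in>{1..n}. i \<noteq> j \<longrightarrow> \<not> (c i x = ?m x \<and> c j x = ?m x)"
    unfolding distr_fst_plan[OF \<pi>] .
  then have "AE z in \<pi>. \<forall>i\<in>{1..n}. \<forall>j\<in>{1..n}. i \<noteq> j \<longrightarrow> \<not> (c i (fst z) = ?m (fst z) \<and> c j (fst z) = ?m (fst z))"
    by (rule AE_distrD[rotated]) (simp add: measurable_plan[OF \<pi>])
  with argmin AE_space show ?thesis
  proof eventually_elim
    case (elim z)
    have "snd z \<in> {1..n}" using elim(2) by (auto simp: space_plan[OF \<pi>])
    then show ?case
      using elim voronoi_index_in[OF n, of c "fst z"] by blast
  qed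
qed

section \<open>The distortion of a plan\<close>

text \<open>The gauge is treated as a function of pairs, in the form in which it is integrated over products of
slices; \<open>n\<close> is the number of points of the quantizer.\<close>

locale gauged_space = prob_space \<xi> for \<xi> :: "'a measure" +
  fixes g :: "'a \<Rightarrow> 'a \<Rightarrow> real" and n :: nat
  assumes gauge_measurable: "(\<lambda>p. g (fst p) (snd p)) \<in> borel_measurable (\<xi> \<Otimes>\<^sub>M \<xi>)"
    and gauge_square_integrable: "integrable (\<xi> \<Otimes>\<^sub>M \<xi>) (\<lambda>p. (g (fst p) (snd p))\<^sup>2)"
    and gauge_symmetric: "AE p in \<xi> \<Otimes>\<^sub>M \<xi>. g (fst p) (snd p) = g (snd p) (fst p)"
    and cells_pos: "n \<ge> 1"
begin

abbreviation block :: "('a \<times> nat) measure \<Rightarrow> ('a \<times> nat) measure \<Rightarrow> nat \<Rightarrow> nat \<Rightarrow> ('a \<times> 'a) measure" where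
  "block \<pi> \<rho> i j \<equiv> slice \<xi> \<pi> i \<Otimes>\<^sub>M slice \<xi> \<rho> j"

definition mass :: "('a \<times> nat) measure \<Rightarrow> nat \<Rightarrow> real" where
  "mass \<pi> i = measure (slice \<xi> \<pi> i) (space \<xi>)"

definition gauge_sum :: "('a \<times> nat) measure \<Rightarrow> nat \<Rightarrow> nat \<Rightarrow> real" where
  "gauge_sum \<pi> i j = (\<integral>p. g (fst p) (snd p) \<partial>block \<pi> \<pi> i j)"

text \<open>If one of the two slices is null, this is \<open>0\<close> by the convention for division, a value that is as
good as any other because the block then contributes nothing to the distortion.\<close>

definition gauge_mean :: "('a \<times> nat) measure \<Rightarrow> nat \<Rightarrow> nat \<Rightarrow> real" where
  "gauge_mean \<pi> i j = gauge_sum \<pi> i j / (mass \<pi> i * mass \<pi> j)"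

text \<open>The bilinear form in two plans whose diagonal is the square of \<open>gw_cost\<close>; the off-diagonal
values appear as directional derivatives.\<close>

definition cross_distortion ::
  "(nat \<Rightarrow> nat \<Rightarrow> real) \<Rightarrow> ('a \<times> nat) measure \<Rightarrow> ('a \<times> nat) measure \<Rightarrow> real" where
  "cross_distortion G \<pi> \<rho> =
    (\<Sum>i\<in>{1..n}. \<Sum>j\<in>{1..n}. \<integral>p. (g (fst p) (snd p) - G i j)\<^sup>2 \<partial>block \<pi> \<rho> i j)"

abbreviation distortion :: "(nat \<Rightarrow> nat \<Rightarrow> real) \<Rightarrow> ('a \<times> nat) measure \<Rightarrow> real" where
  "distortion G \<pi> \<equiv> cross_distortion G \<pi> \<pi>"

sublocale \<xi>\<xi>: prob_space "\<xi> \<Otimes>\<^sub>M \<xi>"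
  by (rule prob_space_pair) (rule prob_space_axioms)+

lemma sets_block [simp]: "sets (block \<pi> \<rho> i j) = sets (\<xi> \<Otimes>\<^sub>M \<xi>)"
  by (intro sets_pair_measure_cong sets_slice)

lemma measurable_block [simp]: "measurable (block \<pi> \<rho> i j) N = measurable (\<xi> \<Otimes>\<^sub>M \<xi>) N"
  by (intro measurable_cong_sets sets_block refl)

lemma block_le:
  assumes "\<pi> \<in> plans \<xi> n" "\<rho> \<in> plans \<xi> n" "i \<in> {1..n}" "j \<in> {1..n}"
  shows "block \<pi> \<rho> i j \<le> \<xi> \<Otimes>\<^sub>M \<xi>"
  by (intro pair_measure_mono finite_measure_axioms sets_slice slice_le[of _ _ n] assms)

lemma integrable_block:
  fixes f :: "_ \<Rightarrow> real"
  assumes "\<pi> \<in> plans \<xi> n" "\<rho> \<in> plans \<xi> n" "i \<in> {1..n}" "j \<in> {1..n}" "integrable (\<xi> \<Otimes>\<^sub>M \<xi>) f"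
  shows "integrable (block \<pi> \<rho> i j) f"
  by (rule integrable_le_measure[OF sets_block block_le[OF assms(1-4)] assms(5)])

lemma finite_measure_block:
  assumes "\<pi> \<in> plans \<xi> n" "\<rho> \<in> plans \<xi> n" "i \<in> {1..n}" "j \<in> {1..n}"
  shows "finite_measure (block \<pi> \<rho> i j)"
  by (rule finite_measure_le_measure[OF \<xi>\<xi>.finite_measure_axioms sets_block block_le[OF assms]])

lemma gauge_integrable: "integrable (\<xi> \<Otimes>\<^sub>M \<xi>) (\<lambda>p. g (fst p) (snd p))"
  by (rule \<xi>\<xi>.square_integrable_imp_integrable[OF gauge_measurable gauge_square_integrable])

lemma gauge_diff_square_integrable: "integrable (\<xi> \<Otimes>\<^sub>M \<xi>) (\<lambda>p. (g (fst p) (snd p) - c)\<^sup>2)"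
proof -
  have "(\<lambda>p. (g (fst p) (snd p) - c)\<^sup>2)
      = (\<lambda>p. (g (fst p) (snd p))\<^sup>2 - 2 * c * g (fst p) (snd p) + c\<^sup>2)"
    by (auto simp: power2_eq_square algebra_simps)
  then show ?thesis
    using gauge_square_integrable gauge_integrable by simp
qed

lemma measure_block_space:
  assumes "\<pi> \<in> plans \<xi> n" "i \<in> {1..n}" "j \<in> {1..n}"
  shows "measure (block \<pi> \<pi> i j) (space (\<xi> \<Otimes>\<^sub>M \<xi>)) = mass \<pi> i * mass \<pi> j"
proof -
  have "sigma_finite_measure (slice \<xi> \<pi> j)"
    by (rule finite_measure.axioms(1)[OF finite_measure_slice[OF prob_space_axioms assms(1,3)]])
  from sigma_finite_measure.emeasure_pair_measure_Times[OF this, of "space \<xi>" "slice \<xi> \<pi> i" "space \<xi>"]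
  show ?thesis by (simp add: measure_def mass_def space_pair_measure enn2real_mult)
qed

lemma block_distortion:
  assumes "\<pi> \<in> plans \<xi> n" "i \<in> {1..n}" "j \<in> {1..n}"
  shows "(\<integral>p. (g (fst p) (snd p) - c)\<^sup>2 \<partial>block \<pi> \<pi> i j)
    = (\<integral>p. (g (fst p) (snd p))\<^sup>2 \<partial>block \<pi> \<pi> i j) - 2 * c * gauge_sum \<pi> i j + c\<^sup>2 * (mass \<pi> i * mass \<pi> j)"
proof -
  interpret b: finite_measure "block \<pi> \<pi> i j" by (rule finite_measure_block) fact+
  note int = integrable_block[OF assms(1) assms gauge_integrable]
    integrable_block[OF assms(1) assms gauge_square_integrable]
  have "space (block \<pi> \<pi> i j) = space (\<xi> \<Otimes>\<^sub>M \<xi>)"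
    by (rule sets_eq_imp_space_eq) simp
  then have mass: "measure (block \<pi> \<pi> i j) (space (block \<pi> \<pi> i j)) = mass \<pi> i * mass \<pi> j"
    using measure_block_space[OF assms] by simp
  have "(\<integral>p. (g (fst p) (snd p) - c)\<^sup>2 \<partial>block \<pi> \<pi> i j)
    = (\<integral>p. (g (fst p) (snd p))\<^sup>2 - 2 * c * g (fst p) (snd p) + c\<^sup>2 \<partial>block \<pi> \<pi> i j)"
    by (auto intro!: Bochner_Integration.integral_cong simp: power2_eq_square algebra_simps)
  also have "\<dots> = (\<integral>p. (g (fst p) (snd p))\<^sup>2 \<partial>block \<pi> \<pi> i j) - 2 * c * gauge_sum \<pi> i j
      + c\<^sup>2 * (mass \<pi> i * mass \<pi> j)"
    using int by (simp add: gauge_sum_def mass)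
  finally show ?thesis .
qed

text \<open>A function of the first coordinates alone only sees the first marginals, which are \<open>\<xi>\<close> for every
plan. In particular the term \<open>\<integral>g\<^sup>2\<close> of the distortion is the same for all plans.\<close>

lemma sum_blocks_nn_integral:
  assumes "\<pi> \<in> plans \<xi> n" "\<rho> \<in> plans \<xi> n" and f: "f \<in> borel_measurable (\<xi> \<Otimes>\<^sub>M \<xi>)"
  shows "(\<Sum>i\<in>{1..n}. \<Sum>j\<in>{1..n}. \<integral>\<^sup>+p. f p \<partial>block \<pi> \<rho> i j) = (\<integral>\<^sup>+p. f p \<partial>(\<xi> \<Otimes>\<^sub>M \<xi>))"
proof -
  interpret \<rho>: prob_space \<rho> by (rule plan_prob_space[OF prob_space_axioms assms(2)])
  have meas: "(\<lambda>q. f (fst (fst q), fst (snd q))) \<in> borel_measurable (\<pi> \<Otimes>\<^sub>M \<rho>)"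
    using assms(1,2) by (intro measurable_compose[OF _ f])
      (simp add: measurable_cong_sets[OF sets_pair_measure_cong[OF sets_plan sets_plan] refl])
  have "(\<integral>\<^sup>+p. f p \<partial>(\<xi> \<Otimes>\<^sub>M \<xi>)) = (\<integral>\<^sup>+x. \<integral>\<^sup>+x'. f (x, x') \<partial>\<xi> \<partial>\<xi>)"
    by (rule nn_integral_fst[OF f, symmetric])
  also have "\<dots> = (\<integral>\<^sup>+z. \<integral>\<^sup>+x'. f (fst z, x') \<partial>\<xi> \<partial>\<pi>)"
    by (rule nn_integral_plan_fst[OF assms(1), symmetric]) (rule borel_measurable_nn_integral_fst[OF f])
  also have "\<dots> = (\<integral>\<^sup>+z. \<integral>\<^sup>+w. f (fst z, fst w) \<partial>\<rho> \<partial>\<pi>)"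
  proof (rule nn_integral_cong)
    fix z assume "z \<in> space \<pi>"
    then have "fst z \<in> space \<xi>" using space_plan[OF assms(1)] by auto
    then show "(\<integral>\<^sup>+x'. f (fst z, x') \<partial>\<xi>) = (\<integral>\<^sup>+w. f (fst z, fst w) \<partial>\<rho>)"
      by (intro nn_integral_plan_fst[OF assms(2), symmetric] measurable_compose[OF _ f]) simp
  qed
  also have "\<dots> = (\<integral>\<^sup>+q. f (fst (fst q), fst (snd q)) \<partial>(\<pi> \<Otimes>\<^sub>M \<rho>))"
    using \<rho>.nn_integral_fst[OF meas] by simp
  also have "\<dots> = (\<Sum>i\<in>{1..n}. \<Sum>j\<in>{1..n}. \<integral>\<^sup>+p. f p \<partial>block \<pi> \<rho> i j)"
    by (subst nn_integral_plan_pair[OF prob_space_axioms assms(1,2)])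
       (simp_all add: measurable_compose[OF _ f])
  finally show ?thesis by simp
qed

lemma sum_blocks_integral:
  fixes f :: "_ \<Rightarrow> real"
  assumes "\<pi> \<in> plans \<xi> n" "\<rho> \<in> plans \<xi> n" "integrable (\<xi> \<Otimes>\<^sub>M \<xi>) f" "\<And>p. 0 \<le> f p"
  shows "(\<Sum>i\<in>{1..n}. \<Sum>j\<in>{1..n}. \<integral>p. f p \<partial>block \<pi> \<rho> i j) = (\<integral>p. f p \<partial>(\<xi> \<Otimes>\<^sub>M \<xi>))"
proof -
  have eq: "ennreal (\<integral>p. f p \<partial>M) = (\<integral>\<^sup>+p. f p \<partial>M)" if "integrable M f" for M
    using nn_integral_eq_integral[OF that] assms(4) by simp
  have "ennreal (\<Sum>i\<in>{1..n}. \<Sum>j\<in>{1..n}. \<integral>p. f p \<partial>block \<pi> \<rho> i j)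
    = (\<Sum>i\<in>{1..n}. \<Sum>j\<in>{1..n}. ennreal (\<integral>p. f p \<partial>block \<pi> \<rho> i j))"
    using assms(4) by (simp add: sum_nonneg)
  also have "\<dots> = (\<Sum>i\<in>{1..n}. \<Sum>j\<in>{1..n}. \<integral>\<^sup>+p. f p \<partial>block \<pi> \<rho> i j)"
    using assms by (intro sum.cong refl eq integrable_block)
  also have "\<dots> = ennreal (\<integral>p. f p \<partial>(\<xi> \<Otimes>\<^sub>M \<xi>))"
    using assms(3) by (simp add: sum_blocks_nn_integral[OF assms(1,2)] eq)
  finally show ?thesis using assms(4) by (simp add: sum_nonneg)
qed

lemma distortion_expand:
  assumes "\<pi> \<in> plans \<xi> n"
  shows "distortion G \<pi> = (\<integral>p. (g (fst p) (snd p))\<^sup>2 \<partial>(\<xi> \<Otimes>\<^sub>M \<xi>))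
    + (\<Sum>i\<in>{1..n}. \<Sum>j\<in>{1..n}. (G i j)\<^sup>2 * (mass \<pi> i * mass \<pi> j) - 2 * G i j * gauge_sum \<pi> i j)"
proof -
  have "distortion G \<pi> = (\<Sum>i\<in>{1..n}. \<Sum>j\<in>{1..n}. (\<integral>p. (g (fst p) (snd p))\<^sup>2 \<partial>block \<pi> \<pi> i j)
      + ((G i j)\<^sup>2 * (mass \<pi> i * mass \<pi> j) - 2 * G i j * gauge_sum \<pi> i j))"
    unfolding cross_distortion_def by (intro sum.cong refl) (simp add: block_distortion[OF assms])
  then show ?thesis
    using sum_blocks_integral[OF assms assms gauge_square_integrable] by (simp add: sum.distrib)
qed

lemma mass_nonneg: "0 \<le> mass \<pi> i"
  by (simp add: mass_def)

lemma cross_distortion_nonneg: "0 \<le> cross_distortion G \<pi> \<rho>"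
  unfolding cross_distortion_def by (intro sum_nonneg integral_nonneg_AE) simp

definition pair_cost :: "(nat \<Rightarrow> nat \<Rightarrow> real) \<Rightarrow> ('a \<times> nat) \<times> ('a \<times> nat) \<Rightarrow> real" where
  "pair_cost G q = (g (fst (fst q)) (fst (snd q)) - G (snd (fst q)) (snd (snd q)))\<^sup>2"

lemma pair_cost_measurable:
  "pair_cost G \<in> borel_measurable ((\<xi> \<Otimes>\<^sub>M count_space {1..n}) \<Otimes>\<^sub>M (\<xi> \<Otimes>\<^sub>M count_space {1..n}))"
    (is "_ \<in> borel_measurable ?M")
proof -
  have g: "(\<lambda>q. g (fst (fst q)) (fst (snd q))) \<in> borel_measurable ?M"
    using measurable_compose[OF _ gauge_measurable, of "\<lambda>q. (fst (fst q), fst (snd q))" ?M] by simp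
  have "(\<lambda>p. G (fst p) (snd p)) \<in> borel_measurable (count_space {1..n} \<Otimes>\<^sub>M count_space {1..n})"
    by (subst pair_measure_countable) auto
  from measurable_compose[OF _ this, of "\<lambda>q. (snd (fst q), snd (snd q))" ?M]
  have "(\<lambda>q. G (snd (fst q)) (snd (snd q))) \<in> borel_measurable ?M" by simp
  with g have "(\<lambda>q. (g (fst (fst q)) (fst (snd q)) - G (snd (fst q)) (snd (snd q)))\<^sup>2) \<in> borel_measurable ?M"
    by simp
  then show ?thesis by (simp add: pair_cost_def[abs_def])
qed

lemma nn_integral_pair_cost:
  assumes "\<pi> \<in> plans \<xi> n" "\<rho> \<in> plans \<xi> n"
  shows "(\<integral>\<^sup>+q. pair_cost G q \<partial>(\<pi> \<Otimes>\<^sub>M \<rho>))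
    = ennreal (cross_distortion G \<pi> \<rho>)"
proof -
  have "(\<integral>\<^sup>+q. pair_cost G q \<partial>(\<pi> \<Otimes>\<^sub>M \<rho>)) = (\<Sum>i\<in>{1..n}. \<Sum>j\<in>{1..n}.
      \<integral>\<^sup>+p. ennreal ((g (fst p) (snd p) - G i j)\<^sup>2) \<partial>block \<pi> \<rho> i j)"
    using measurable_compose[OF pair_cost_measurable measurable_ennreal]
    by (subst nn_integral_plan_pair[OF prob_space_axioms assms]) (simp_all add: pair_cost_def)
  also have "\<dots> = (\<Sum>i\<in>{1..n}. \<Sum>j\<in>{1..n}. ennreal (\<integral>p. (g (fst p) (snd p) - G i j)\<^sup>2 \<partial>block \<pi> \<rho> i j))"
    using assms by (intro sum.cong refl nn_integral_eq_integral integrable_block gauge_diff_square_integrable) auto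
  finally show ?thesis by (simp add: cross_distortion_def sum_nonneg)
qed

lemma gw_cost_eq_distortion:
  assumes "\<pi> \<in> plans \<xi> n"
  shows "gw_cost g G \<pi> = sqrt (distortion G \<pi>)"
proof -
  have "(\<integral>((x, y), (x', y')). \<bar>g x x' - G y y'\<bar>\<^sup>2 \<partial>(\<pi> \<Otimes>\<^sub>M \<pi>)) = (\<integral>q. pair_cost G q \<partial>(\<pi> \<Otimes>\<^sub>M \<pi>))"
    by (intro Bochner_Integration.integral_cong) (auto simp: pair_cost_def split: prod.splits)
  also have "\<dots> = enn2real (\<integral>\<^sup>+q. pair_cost G q \<partial>(\<pi> \<Otimes>\<^sub>M \<pi>))"
  proof (rule integral_eq_nn_integral)
    show "pair_cost G \<in> borel_measurable (\<pi> \<Otimes>\<^sub>M \<pi>)"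
      using pair_cost_measurable[of G]
        measurable_cong_sets[OF sets_pair_measure_cong[OF sets_plan[OF assms] sets_plan[OF assms]] refl]
      by blast
  qed (simp add: pair_cost_def)
  also have "\<dots> = distortion G \<pi>"
    unfolding nn_integral_pair_cost[OF assms assms]
    by (simp add: cross_distortion_nonneg)
  finally show ?thesis by (simp add: gw_cost_def)
qed

text \<open>Symmetry of the gauge is known \<open>\<xi> \<otimes> \<xi>\<close>-almost everywhere; it can be used in a block because blocks
are dominated by \<open>\<xi> \<otimes> \<xi>\<close>.\<close>

lemma block_integral_swap:
  fixes f :: "real \<Rightarrow> real"
  assumes "\<pi> \<in> plans \<xi> n" "\<rho> \<in> plans \<xi> n" "i \<in> {1..n}" "j \<in> {1..n}" and f: "f \<in> borel_measurable borel"
  shows "(\<integral>p. f (g (fst p) (snd p)) \<partial>block \<pi> \<rho> i j) = (\<integral>p. f (g (fst p) (snd p)) \<partial>block \<rho> \<pi> j i)"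
proof -
  interpret i: finite_measure "slice \<xi> \<pi> i" by (rule finite_measure_slice[OF prob_space_axioms assms(1,3)])
  interpret j: finite_measure "slice \<xi> \<rho> j" by (rule finite_measure_slice[OF prob_space_axioms assms(2,4)])
  interpret P: pair_sigma_finite "slice \<xi> \<rho> j" "slice \<xi> \<pi> i" ..
  have AE: "AE p in block \<pi> \<rho> i j. g (fst p) (snd p) = g (snd p) (fst p)"
    by (rule AE_le_measure[OF sets_block block_le[OF assms(1-4)] gauge_symmetric])
  have "(\<lambda>p. g (snd p) (fst p)) \<in> borel_measurable (\<xi> \<Otimes>\<^sub>M \<xi>)"
    using measurable_compose[OF _ gauge_measurable, of "\<lambda>p. (snd p, fst p)" "\<xi> \<Otimes>\<^sub>M \<xi>"] by simp
  note meas = measurable_compose[OF this f] measurable_compose[OF gauge_measurable f]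
  have "(\<integral>p. f (g (fst p) (snd p)) \<partial>block \<pi> \<rho> i j) = (\<integral>p. f (g (snd p) (fst p)) \<partial>block \<pi> \<rho> i j)"
    using AE meas by (intro integral_cong_AE) auto
  also have "\<dots> = (\<integral>p. f (g (fst p) (snd p)) \<partial>block \<rho> \<pi> j i)"
    using P.integral_product_swap[of "\<lambda>p. f (g (fst p) (snd p))"] meas
    by (simp add: case_prod_beta')
  finally show ?thesis .
qed

lemma gauge_mean_symmetric:
  assumes "\<pi> \<in> plans \<xi> n" "i \<in> {1..n}" "j \<in> {1..n}"
  shows "gauge_mean \<pi> i j = gauge_mean \<pi> j i"
  using block_integral_swap[OF assms(1) assms, of "\<lambda>x. x"]
  by (simp add: gauge_mean_def gauge_sum_def mult.commute)

end

section \<open>Existence of a minimizer\<close>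

text \<open>The polynomial on the right expresses one term of the distortion, and its vertex is at \<open>c = b / u\<close>.\<close>

lemma quadratic_lower_bound:
  fixes a b c u :: real
  assumes "u > 0"
  shows "a - b\<^sup>2 / u \<le> a - 2 * c * b + c\<^sup>2 * u"
proof -
  have "a - 2 * c * b + c\<^sup>2 * u - (a - b\<^sup>2 / u) = (c * u - b)\<^sup>2 / u"
    using assms by (simp add: field_simps power2_eq_square)
  also have "\<dots> \<ge> 0" using assms by simp
  finally show ?thesis by simp
qed

lemma quadratic_at_vertex:
  fixes a b u :: real
  assumes "u \<noteq> 0"
  shows "a - 2 * (b / u) * b + (b / u)\<^sup>2 * u = a - b\<^sup>2 / u"
  using assms by (simp add: power2_eq_square)

context gauged_space
begin

lemma block_integral_tendsto:
  fixes f :: "'a \<times> 'a \<Rightarrow> real"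
  assumes "F \<noteq> bot" and \<pi>: "\<And>k. \<pi> k \<in> plans \<xi> n" and \<rho>: "\<rho> \<in> plans \<xi> n"
    and lim: "\<And>i A. i \<in> {1..n} \<Longrightarrow> A \<in> sets \<xi> \<Longrightarrow>
      ((\<lambda>k. measure (slice \<xi> (\<pi> k) i) A) \<longlongrightarrow> measure (slice \<xi> \<rho> i) A) F"
    and ij: "i \<in> {1..n}" "j \<in> {1..n}" and f: "integrable (\<xi> \<Otimes>\<^sub>M \<xi>) f"
  shows "((\<lambda>k. \<integral>p. f p \<partial>block (\<pi> k) (\<pi> k) i j) \<longlongrightarrow> (\<integral>p. f p \<partial>block \<rho> \<rho> i j)) F"
proof (rule setwise_tendsto_integral[OF sets_block _ sets_block _ _ f])
  show "block (\<pi> k) (\<pi> k) i j \<le> \<xi> \<Otimes>\<^sub>M \<xi>" for k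
    by (intro block_le \<pi> ij)
  show "block \<rho> \<rho> i j \<le> \<xi> \<Otimes>\<^sub>M \<xi>"
    by (intro block_le \<rho> ij)
  show "((\<lambda>k. measure (block (\<pi> k) (\<pi> k) i j) S) \<longlongrightarrow> measure (block \<rho> \<rho> i j) S) F"
    if "S \<in> sets (\<xi> \<Otimes>\<^sub>M \<xi>)" for S
    by (rule setwise_tendsto_pair_measure[OF finite_measure_axioms finite_measure_axioms assms(1)
          sets_slice slice_le[OF \<pi> ij(1)] sets_slice slice_le[OF \<pi> ij(2)]
          sets_slice slice_le[OF \<rho> ij(1)] sets_slice slice_le[OF \<rho> ij(2)]
          lim[OF ij(1)] lim[OF ij(2)] that])
qed

text \<open>Lower semicontinuity of one term of the distortion jointly in the plan and in the entry \<open>c\<close> of the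
matrix, without any bound on \<open>c\<close>: the lower bounds \<open>l k\<close> do not involve \<open>c k\<close>, and they converge to the
term of the limiting plan with its best entry.\<close>

lemma block_distortion_lower_limit:
  assumes "F \<noteq> bot" and \<pi>: "\<And>k. \<pi> k \<in> plans \<xi> n" and \<rho>: "\<rho> \<in> plans \<xi> n"
    and lim: "\<And>i A. i \<in> {1..n} \<Longrightarrow> A \<in> sets \<xi> \<Longrightarrow>
      ((\<lambda>k. measure (slice \<xi> (\<pi> k) i) A) \<longlongrightarrow> measure (slice \<xi> \<rho> i) A) F"
    and ij: "i \<in> {1..n}" "j \<in> {1..n}"
  shows "\<exists>l. (l \<longlongrightarrow> (\<integral>p. (g (fst p) (snd p) - gauge_mean \<rho> i j)\<^sup>2 \<partial>block \<rho> \<rho> i j)) F \<and>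
    (\<forall>\<^sub>F k in F. l k \<le> (\<integral>p. (g (fst p) (snd p) - c k)\<^sup>2 \<partial>block (\<pi> k) (\<pi> k) i j))"
proof -
  let ?u = "\<lambda>\<sigma>. mass \<sigma> i * mass \<sigma> j"
  let ?a = "\<lambda>\<sigma>. \<integral>p. (g (fst p) (snd p))\<^sup>2 \<partial>block \<sigma> \<sigma> i j"
  let ?b = "\<lambda>\<sigma>. gauge_sum \<sigma> i j"
  have u: "((\<lambda>k. ?u (\<pi> k)) \<longlongrightarrow> ?u \<rho>) F"
    unfolding mass_def by (intro tendsto_mult lim ij sets.top)
  have a: "((\<lambda>k. ?a (\<pi> k)) \<longlongrightarrow> ?a \<rho>) F"
    by (rule block_integral_tendsto[OF assms(1) \<pi> \<rho> lim ij gauge_square_integrable])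
  have b: "((\<lambda>k. ?b (\<pi> k)) \<longlongrightarrow> ?b \<rho>) F"
    unfolding gauge_sum_def
    by (rule block_integral_tendsto[OF assms(1) \<pi> \<rho> lim ij gauge_integrable])
  show ?thesis
  proof (cases "?u \<rho> = 0")
    case True
    \<comment> \<open>The limiting block is null, so the trivial lower bound is already sharp.\<close>
    have "emeasure (block \<rho> \<rho> i j) (space (\<xi> \<Otimes>\<^sub>M \<xi>)) = 0"
      using measure_block_space[OF \<rho> ij] True
      by (simp add: finite_measure.emeasure_eq_measure[OF finite_measure_block[OF \<rho> \<rho> ij]])
    then have "space (\<xi> \<Otimes>\<^sub>M \<xi>) \<in> null_sets (block \<rho> \<rho> i j)"
      by (simp add: null_sets_def)
    then have "AE p in block \<rho> \<rho> i j. (g (fst p) (snd p) - gauge_mean \<rho> i j)\<^sup>2 = 0"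
      using sets_eq_imp_space_eq[OF sets_block[of \<rho> i \<rho> j]] by (auto intro!: AE_I')
    then have "(\<integral>p. (g (fst p) (snd p) - gauge_mean \<rho> i j)\<^sup>2 \<partial>block \<rho> \<rho> i j) = 0"
      by (rule integral_eq_zero_AE)
    then show ?thesis
      by (intro exI[of _ "\<lambda>_. 0"]) (auto intro!: integral_nonneg_AE)
  next
    case False
    then have pos: "?u \<rho> > 0" using mass_nonneg[of \<rho> i] mass_nonneg[of \<rho> j]
      by (simp add: less_le)
    have "(\<integral>p. (g (fst p) (snd p) - gauge_mean \<rho> i j)\<^sup>2 \<partial>block \<rho> \<rho> i j) = ?a \<rho> - (?b \<rho>)\<^sup>2 / ?u \<rho>"
      using quadratic_at_vertex[OF False, of "?a \<rho>" "?b \<rho>"]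
      unfolding block_distortion[OF \<rho> ij] gauge_mean_def .
    moreover have "((\<lambda>k. ?a (\<pi> k) - (?b (\<pi> k))\<^sup>2 / ?u (\<pi> k)) \<longlongrightarrow> ?a \<rho> - (?b \<rho>)\<^sup>2 / ?u \<rho>) F"
      by (intro tendsto_intros a b u False)
    moreover have "\<forall>\<^sub>F k in F. ?u (\<pi> k) > 0"
      by (rule order_tendstoD(1)[OF u pos])
    then have "\<forall>\<^sub>F k in F. ?a (\<pi> k) - (?b (\<pi> k))\<^sup>2 / ?u (\<pi> k)
        \<le> (\<integral>p. (g (fst p) (snd p) - c k)\<^sup>2 \<partial>block (\<pi> k) (\<pi> k) i j)"
      by (rule eventually_mono) (simp add: block_distortion[OF \<pi> ij] quadratic_lower_bound)
    ultimately show ?thesis by auto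
  qed
qed

lemma plans_nonempty: "\<exists>\<pi>. \<pi> \<in> plans \<xi> n"
  using graph_plan[of "\<lambda>_. 1" \<xi> n] cells_pos by auto

text \<open>The direct method: take a cluster plan of a minimizing sequence and equip it with its own means. The
matrices of the sequence are never asked to converge.\<close>

lemma distortion_minimizer_exists:
  obtains G \<pi> where "\<And>i j. i \<in> {1..n} \<Longrightarrow> j \<in> {1..n} \<Longrightarrow> G i j = G j i" "\<pi> \<in> plans \<xi> n"
    "\<And>G' \<pi>'. \<pi>' \<in> plans \<xi> n \<Longrightarrow> distortion G \<pi> \<le> distortion G' \<pi>'"
proof -
  define D where "D = {distortion G \<pi> | G \<pi>. \<pi> \<in> plans \<xi> n}"
  have bdd: "bdd_below D"
    unfolding D_def by (rule bdd_belowI[of _ 0]) (auto simp: cross_distortion_nonneg)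
  have "D \<noteq> {}" unfolding D_def using plans_nonempty by auto
  have "\<exists>G \<pi>. \<pi> \<in> plans \<xi> n \<and> distortion G \<pi> < Inf D + 1 / Suc k" for k
  proof -
    have "Inf D < Inf D + 1 / Suc k" by simp
    from cInf_lessD[OF \<open>D \<noteq> {}\<close> this] show ?thesis unfolding D_def by auto
  qed
  then obtain H \<sigma> where \<sigma>: "\<And>k. \<sigma> k \<in> plans \<xi> n"
    and min: "\<And>k. distortion (H k) (\<sigma> k) < Inf D + 1 / Suc k"
    by metis
  obtain F \<rho> where F: "F \<noteq> bot" "F \<le> sequentially" and \<rho>: "\<rho> \<in> plans \<xi> n"
    and lim: "\<And>i A. i \<in> {1..n} \<Longrightarrow> A \<in> sets \<xi> \<Longrightarrow>
      ((\<lambda>k. measure (slice \<xi> (\<sigma> k) i) A) \<longlongrightarrow> measure (slice \<xi> \<rho> i) A) F"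
    by (rule plans_cluster[where \<pi> = \<sigma>, OF prob_space_axioms \<sigma>]) (rule that; blast)
  \<comment> \<open>Lower bounds are selected for all pairs of indices, so that they can be summed.\<close>
  define R where "R i j l \<longleftrightarrow>
      (l \<longlongrightarrow> (\<integral>p. (g (fst p) (snd p) - gauge_mean \<rho> i j)\<^sup>2 \<partial>block \<rho> \<rho> i j)) F \<and>
      (\<forall>\<^sub>F k in F. l k \<le> (\<integral>p. (g (fst p) (snd p) - H k i j)\<^sup>2 \<partial>block (\<sigma> k) (\<sigma> k) i j))" for i j l
  define l where "l i j = (SOME l. R i j l)" for i j
  have "\<exists>l. R i j l" if "i \<in> {1..n}" "j \<in> {1..n}" for i j
    unfolding R_def by (rule block_distortion_lower_limit[OF F(1) \<sigma> \<rho> lim that])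
  then have "R i j (l i j)" if "i \<in> {1..n}" "j \<in> {1..n}" for i j
    unfolding l_def using that by (intro someI_ex[of "R i j"])
  then have
    l: "\<And>i j. i \<in> {1..n} \<Longrightarrow> j \<in> {1..n} \<Longrightarrow>
      (l i j \<longlongrightarrow> (\<integral>p. (g (fst p) (snd p) - gauge_mean \<rho> i j)\<^sup>2 \<partial>block \<rho> \<rho> i j)) F"
    "\<And>i j. i \<in> {1..n} \<Longrightarrow> j \<in> {1..n} \<Longrightarrow>
      \<forall>\<^sub>F k in F. l i j k \<le> (\<integral>p. (g (fst p) (snd p) - H k i j)\<^sup>2 \<partial>block (\<sigma> k) (\<sigma> k) i j)"
    unfolding R_def by blast+
  have "distortion (gauge_mean \<rho>) \<rho> \<le> Inf D"
  proof (rule tendsto_le[OF F(1)])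
    show "((\<lambda>k. \<Sum>i\<in>{1..n}. \<Sum>j\<in>{1..n}. l i j k) \<longlongrightarrow> distortion (gauge_mean \<rho>) \<rho>) F"
      unfolding cross_distortion_def by (intro tendsto_sum l)
    have "(\<lambda>k. Inf D + 1 / Suc k) \<longlonglongrightarrow> Inf D + 0"
      by (intro tendsto_intros LIMSEQ_Suc[OF lim_1_over_n])
    then show "((\<lambda>k. Inf D + 1 / Suc k) \<longlongrightarrow> Inf D) F"
      using F(2) by (simp add: tendsto_mono)
    have "\<forall>\<^sub>F k in F. \<forall>i\<in>{1..n}. \<forall>j\<in>{1..n}.
        l i j k \<le> (\<integral>p. (g (fst p) (snd p) - H k i j)\<^sup>2 \<partial>block (\<sigma> k) (\<sigma> k) i j)"
      using l(2) by (intro eventually_ball_finite ballI) auto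
    then show "\<forall>\<^sub>F k in F. (\<Sum>i\<in>{1..n}. \<Sum>j\<in>{1..n}. l i j k) \<le> Inf D + 1 / Suc k"
    proof (rule eventually_mono)
      fix k assume "\<forall>i\<in>{1..n}. \<forall>j\<in>{1..n}.
        l i j k \<le> (\<integral>p. (g (fst p) (snd p) - H k i j)\<^sup>2 \<partial>block (\<sigma> k) (\<sigma> k) i j)"
      then have "(\<Sum>i\<in>{1..n}. \<Sum>j\<in>{1..n}. l i j k) \<le> distortion (H k) (\<sigma> k)"
        unfolding cross_distortion_def by (intro sum_mono) auto
      with min[of k] show "(\<Sum>i\<in>{1..n}. \<Sum>j\<in>{1..n}. l i j k) \<le> Inf D + 1 / Suc k"
        by linarith
    qed
  qed
  moreover have "Inf D \<le> distortion G' \<pi>'" if "\<pi>' \<in> plans \<xi> n" for G' \<pi>'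
    using that by (intro cInf_lower bdd) (auto simp: D_def)
  ultimately show thesis
    by (intro that[of "gauge_mean \<rho>" \<rho>] gauge_mean_symmetric \<rho>) (auto intro: order_trans)
qed

end

section \<open>First-order conditions\<close>

lemma AE_eq_of_nn_integral_le:
  fixes f h :: "'a \<Rightarrow> ennreal"
  assumes "f \<in> borel_measurable M" "h \<in> borel_measurable M"
    and le: "\<And>x. x \<in> space M \<Longrightarrow> f x \<le> h x"
    and int: "(\<integral>\<^sup>+x. h x \<partial>M) \<le> (\<integral>\<^sup>+x. f x \<partial>M)" "(\<integral>\<^sup>+x. h x \<partial>M) < \<infinity>"
  shows "AE x in M. h x = f x"
proof -
  have fin: "(\<integral>\<^sup>+x. f x \<partial>M) \<noteq> \<infinity>"
    using le_less_trans[OF nn_integral_mono[OF le] int(2)] by simp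
  have "(\<integral>\<^sup>+x. h x - f x \<partial>M) = (\<integral>\<^sup>+x. h x \<partial>M) - (\<integral>\<^sup>+x. f x \<partial>M)"
    using assms fin by (intro nn_integral_diff) auto
  also have "\<dots> = 0" using int(1) fin by (simp add: diff_eq_0_iff_ennreal less_top)
  finally have "AE x in M. h x - f x = 0"
    using assms by (subst (asm) nn_integral_0_iff_AE) auto
  then show ?thesis
  proof (rule AE_mp, intro AE_I2 impI)
    fix x assume "x \<in> space M" "h x - f x = 0"
    then have "h x \<le> f x" by (simp add: diff_eq_0_iff_ennreal)
    with le[OF \<open>x \<in> space M\<close>] show "h x = f x" by simp
  qed
qed

context gauged_space
begin

text \<open>Completing the square: replacing \<open>G\<close> by the means lowers the distortion by the nonnegative sum of
\<open>\<upsilon>\<^sub>i \<upsilon>\<^sub>j (G\<^sub>i\<^sub>j - mean\<^sub>i\<^sub>j)\<^sup>2\<close>, whose weights are positive.\<close>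

lemma optimal_gauge_is_mean:
  assumes \<pi>: "\<pi> \<in> plans \<xi> n" and pos: "\<And>i. i \<in> {1..n} \<Longrightarrow> 0 < mass \<pi> i"
    and min: "distortion G \<pi> \<le> distortion (gauge_mean \<pi>) \<pi>"
    and ij: "i \<in> {1..n}" "j \<in> {1..n}"
  shows "G i j = gauge_mean \<pi> i j"
proof -
  let ?d = "\<lambda>i j. mass \<pi> i * mass \<pi> j * (G i j - gauge_mean \<pi> i j)\<^sup>2"
  have "distortion G \<pi> - distortion (gauge_mean \<pi>) \<pi> = (\<Sum>i\<in>{1..n}. \<Sum>j\<in>{1..n}. ?d i j)"
    unfolding distortion_expand[OF \<pi>] add_diff_cancel_left sum_subtractf[symmetric]
  proof (intro sum.cong refl)
    fix i j assume ij: "i \<in> {1..n}" "j \<in> {1..n}"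
    have "gauge_sum \<pi> i j = gauge_mean \<pi> i j * (mass \<pi> i * mass \<pi> j)"
      using pos[OF ij(1)] pos[OF ij(2)] by (simp add: gauge_mean_def)
    then show "(G i j)\<^sup>2 * (mass \<pi> i * mass \<pi> j) - 2 * G i j * gauge_sum \<pi> i j -
        ((gauge_mean \<pi> i j)\<^sup>2 * (mass \<pi> i * mass \<pi> j) - 2 * gauge_mean \<pi> i j * gauge_sum \<pi> i j) = ?d i j"
      by (simp add: power2_eq_square algebra_simps)
  qed
  moreover have nonneg: "0 \<le> ?d i j" for i j by (simp add: mass_nonneg)
  ultimately have "(\<Sum>i\<in>{1..n}. \<Sum>j\<in>{1..n}. ?d i j) = 0"
    using min by (intro antisym sum_nonneg) auto
  then have "\<forall>i\<in>{1..n}. (\<Sum>j\<in>{1..n}. ?d i j) = 0"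
    using nonneg by (subst (asm) sum_nonneg_eq_0_iff) (auto intro!: sum_nonneg)
  with ij(1) have "(\<Sum>j\<in>{1..n}. ?d i j) = 0" by blast
  then have "\<forall>j\<in>{1..n}. ?d i j = 0"
    using nonneg by (subst (asm) sum_nonneg_eq_0_iff) auto
  with ij(2) have "?d i j = 0" by blast
  then show ?thesis using pos[OF ij(1)] pos[OF ij(2)] by simp
qed

lemma distortion_at_mean:
  assumes \<pi>: "\<pi> \<in> plans \<xi> n" and pos: "\<And>i. i \<in> {1..n} \<Longrightarrow> 0 < mass \<pi> i"
    and G: "\<And>i j. i \<in> {1..n} \<Longrightarrow> j \<in> {1..n} \<Longrightarrow> G i j = gauge_mean \<pi> i j"
  shows "distortion G \<pi> = (\<integral>p. (g (fst p) (snd p))\<^sup>2 \<partial>(\<xi> \<Otimes>\<^sub>M \<xi>))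
    - (\<Sum>i\<in>{1..n}. \<Sum>j\<in>{1..n}. (G i j)\<^sup>2 * mass \<pi> i * mass \<pi> j)"
proof -
  have "(G i j)\<^sup>2 * (mass \<pi> i * mass \<pi> j) - 2 * G i j * gauge_sum \<pi> i j
      = - ((G i j)\<^sup>2 * mass \<pi> i * mass \<pi> j)" if "i \<in> {1..n}" "j \<in> {1..n}" for i j
  proof -
    have "gauge_sum \<pi> i j = G i j * (mass \<pi> i * mass \<pi> j)"
      using pos[OF that(1)] pos[OF that(2)] by (simp add: G[OF that] gauge_mean_def)
    then show ?thesis by (simp add: power2_eq_square algebra_simps)
  qed
  then have "(\<Sum>i\<in>{1..n}. \<Sum>j\<in>{1..n}. (G i j)\<^sup>2 * (mass \<pi> i * mass \<pi> j) - 2 * G i j * gauge_sum \<pi> i j)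
      = (\<Sum>i\<in>{1..n}. \<Sum>j\<in>{1..n}. - ((G i j)\<^sup>2 * mass \<pi> i * mass \<pi> j))"
    by (intro sum.cong refl)
  then show ?thesis
    unfolding distortion_expand[OF \<pi>] by (simp add: sum_negf)
qed

lemma pair_cost_measurable_plans:
  assumes "\<pi> \<in> plans \<xi> n" "\<rho> \<in> plans \<xi> n"
  shows "(\<lambda>q. ennreal (pair_cost G q)) \<in> borel_measurable (\<pi> \<Otimes>\<^sub>M \<rho>)"
  using measurable_compose[OF pair_cost_measurable measurable_ennreal]
    measurable_cong_sets[OF sets_pair_measure_cong[OF sets_plan[OF assms(1)] sets_plan[OF assms(2)]] refl]
  by blast

lemma cross_distortion_commute:
  assumes "\<pi> \<in> plans \<xi> n" "\<rho> \<in> plans \<xi> n"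
    and G: "\<And>i j. i \<in> {1..n} \<Longrightarrow> j \<in> {1..n} \<Longrightarrow> G i j = G j i"
  shows "cross_distortion G \<pi> \<rho> = cross_distortion G \<rho> \<pi>"
proof -
  have "cross_distortion G \<pi> \<rho>
    = (\<Sum>i\<in>{1..n}. \<Sum>j\<in>{1..n}. \<integral>p. (g (fst p) (snd p) - G j i)\<^sup>2 \<partial>block \<rho> \<pi> j i)"
    unfolding cross_distortion_def
  proof (intro sum.cong refl)
    fix i j assume "i \<in> {1..n}" "j \<in> {1..n}"
    then show "(\<integral>p. (g (fst p) (snd p) - G i j)\<^sup>2 \<partial>block \<pi> \<rho> i j)
        = (\<integral>p. (g (fst p) (snd p) - G j i)\<^sup>2 \<partial>block \<rho> \<pi> j i)"
      using block_integral_swap[OF assms(1,2), of i j "\<lambda>x. (x - G i j)\<^sup>2"] G[of i j] by simp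
  qed
  then show ?thesis
    unfolding cross_distortion_def by (subst (asm) sum.swap)
qed

lemma nn_integral_cross_distortion:
  assumes "\<pi> \<in> plans \<xi> n" "\<rho> \<in> plans \<xi> n"
  shows "(\<integral>\<^sup>+z. \<integral>\<^sup>+w. pair_cost G (z, w) \<partial>\<rho> \<partial>\<pi>) = cross_distortion G \<pi> \<rho>"
proof -
  interpret \<rho>: prob_space \<rho> by (rule plan_prob_space[OF prob_space_axioms assms(2)])
  show ?thesis
    using nn_integral_pair_cost[OF assms, of G] \<rho>.nn_integral_fst[OF pair_cost_measurable_plans[OF assms, of G]]
    by (simp add: cross_distortion_def)
qed

lemma inner_cost_measurable:
  assumes "\<rho> \<in> plans \<xi> n"
  shows "(\<lambda>z. \<integral>\<^sup>+w. pair_cost G (z, w) \<partial>\<rho>) \<in> borel_measurable (\<xi> \<Otimes>\<^sub>M count_space {1..n})"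
proof -
  interpret \<rho>: prob_space \<rho> by (rule plan_prob_space[OF prob_space_axioms assms])
  show ?thesis
    using \<rho>.borel_measurable_nn_integral_fst[OF pair_cost_measurable_plans[OF assms assms, of G]]
    by (simp add: measurable_plan[OF assms])
qed

text \<open>The expansion of a quadratic form along a segment; symmetry of the gauge and of \<open>G\<close> merges the two
mixed terms.\<close>

lemma distortion_mixture:
  assumes \<pi>: "\<pi> \<in> plans \<xi> n" and \<rho>: "\<rho> \<in> plans \<xi> n" and t: "0 \<le> t" "t \<le> 1"
    and G: "\<And>i j. i \<in> {1..n} \<Longrightarrow> j \<in> {1..n} \<Longrightarrow> G i j = G j i"
  obtains \<sigma> where "\<sigma> \<in> plans \<xi> n"
    "distortion G \<sigma> = (1 - t)\<^sup>2 * distortion G \<pi> + 2 * t * (1 - t) * cross_distortion G \<pi> \<rho>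
      + t\<^sup>2 * distortion G \<rho>"
proof -
  obtain \<sigma> where \<sigma>: "\<sigma> \<in> plans \<xi> n"
    and int: "\<And>f. f \<in> borel_measurable (\<xi> \<Otimes>\<^sub>M count_space {1..n}) \<Longrightarrow>
      (\<integral>\<^sup>+z. f z \<partial>\<sigma>) = ennreal (1 - t) * (\<integral>\<^sup>+z. f z \<partial>\<pi>) + ennreal t * (\<integral>\<^sup>+z. f z \<partial>\<rho>)"
    using mixture_plan[OF prob_space_axioms \<pi> \<rho> t] by blast
  let ?c = "\<lambda>\<tau> z. \<integral>\<^sup>+w. pair_cost G (z, w) \<partial>\<tau>"
  have inner: "?c \<sigma> z = ennreal (1 - t) * ?c \<pi> z + ennreal t * ?c \<rho> z" if "z \<in> space \<tau>" "\<tau> \<in> plans \<xi> n" for \<tau> z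
  proof (rule int)
    have "z \<in> space (\<xi> \<Otimes>\<^sub>M count_space {1..n})"
      using that sets_eq_imp_space_eq[OF sets_plan[OF that(2)]] by simp
    then show "(\<lambda>w. ennreal (pair_cost G (z, w))) \<in> borel_measurable (\<xi> \<Otimes>\<^sub>M count_space {1..n})"
      by (intro measurable_compose[OF measurable_Pair1'
            measurable_compose[OF pair_cost_measurable measurable_ennreal]])
  qed
  have outer: "(\<integral>\<^sup>+z. ?c \<sigma> z \<partial>\<tau>) = (1 - t) * cross_distortion G \<tau> \<pi> + t * cross_distortion G \<tau> \<rho>"
    if \<tau>: "\<tau> \<in> plans \<xi> n" for \<tau>
  proof -
    have "(\<integral>\<^sup>+z. ?c \<sigma> z \<partial>\<tau>) = (\<integral>\<^sup>+z. ennreal (1 - t) * ?c \<pi> z + ennreal t * ?c \<rho> z \<partial>\<tau>)"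
      using inner[OF _ \<tau>] by (intro nn_integral_cong)
    also have "\<dots> = ennreal (1 - t) * (\<integral>\<^sup>+z. ?c \<pi> z \<partial>\<tau>) + ennreal t * (\<integral>\<^sup>+z. ?c \<rho> z \<partial>\<tau>)"
      using inner_cost_measurable[OF \<pi>, of G] inner_cost_measurable[OF \<rho>, of G]
      by (simp add: nn_integral_add nn_integral_cmult measurable_plan[OF \<tau>])
    also have "\<dots> = ennreal ((1 - t) * cross_distortion G \<tau> \<pi> + t * cross_distortion G \<tau> \<rho>)"
      using t by (simp add: nn_integral_cross_distortion[OF \<tau>] \<pi> \<rho> ennreal_mult cross_distortion_nonneg)
    finally show ?thesis .
  qed
  have "ennreal (distortion G \<sigma>) = (\<integral>\<^sup>+z. ?c \<sigma> z \<partial>\<sigma>)"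
    by (simp add: nn_integral_cross_distortion[OF \<sigma> \<sigma>])
  also have "\<dots> = ennreal (1 - t) * (\<integral>\<^sup>+z. ?c \<sigma> z \<partial>\<pi>) + ennreal t * (\<integral>\<^sup>+z. ?c \<sigma> z \<partial>\<rho>)"
    by (rule int) (rule inner_cost_measurable[OF \<sigma>])
  also have "\<dots> = ennreal ((1 - t) * ((1 - t) * cross_distortion G \<pi> \<pi> + t * cross_distortion G \<pi> \<rho>)
      + t * ((1 - t) * cross_distortion G \<rho> \<pi> + t * cross_distortion G \<rho> \<rho>))"
    using t by (simp add: outer[OF \<pi>] outer[OF \<rho>] ennreal_mult cross_distortion_nonneg)
  finally have "distortion G \<sigma> = (1 - t) * ((1 - t) * cross_distortion G \<pi> \<pi> + t * cross_distortion G \<pi> \<rho>)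
      + t * ((1 - t) * cross_distortion G \<rho> \<pi> + t * cross_distortion G \<rho> \<rho>)"
    using t by (subst (asm) ennreal_inj) (simp_all add: cross_distortion_nonneg)
  also have "\<dots> = (1 - t)\<^sup>2 * distortion G \<pi> + 2 * t * (1 - t) * cross_distortion G \<pi> \<rho> + t\<^sup>2 * distortion G \<rho>"
    using cross_distortion_commute[where G = G, OF \<rho> \<pi> G]
    by (simp add: power2_eq_square algebra_simps)
  finally show thesis by (rule that[OF \<sigma>])
qed

text \<open>The derivative at \<open>\<pi>\<close> of the distortion in the direction of \<open>\<rho>\<close> is twice the excess of the
right-hand side over the left-hand side, and it cannot be negative at a minimizer.\<close>

lemma first_variation:
  assumes \<pi>: "\<pi> \<in> plans \<xi> n" and \<rho>: "\<rho> \<in> plans \<xi> n"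
    and G: "\<And>i j. i \<in> {1..n} \<Longrightarrow> j \<in> {1..n} \<Longrightarrow> G i j = G j i"
    and min: "\<And>\<sigma>. \<sigma> \<in> plans \<xi> n \<Longrightarrow> distortion G \<pi> \<le> distortion G \<sigma>"
  shows "distortion G \<pi> \<le> cross_distortion G \<pi> \<rho>"
proof -
  \<comment> \<open>The increment of the distortion at the mixture with weight \<open>t\<close>, divided by \<open>t\<close>.\<close>
  define h where "h t = 2 * (1 - t) * cross_distortion G \<pi> \<rho> + t * distortion G \<rho> - (2 - t) * distortion G \<pi>" for t
  have nonneg: "0 \<le> h t" if "0 < t" "t < 1" for t
  proof -
    have t: "0 \<le> t" "t \<le> 1" using that by simp_all
    obtain \<sigma> where "\<sigma> \<in> plans \<xi> n" "distortion G \<sigma> = (1 - t)\<^sup>2 * distortion G \<pi>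
        + 2 * t * (1 - t) * cross_distortion G \<pi> \<rho> + t\<^sup>2 * distortion G \<rho>"
      by (rule distortion_mixture[where G = G, OF \<pi> \<rho> t G])
    then have "0 \<le> t * h t"
      using min[of \<sigma>] by (simp add: h_def power2_eq_square algebra_simps)
    then show ?thesis using that by (simp add: zero_le_mult_iff)
  qed
  have "(h \<longlongrightarrow> h 0) (at_right 0)"
    unfolding h_def by (intro tendsto_intros)
  moreover have "eventually (\<lambda>t. 0 \<le> h t) (at_right (0::real))"
    unfolding eventually_at_right_field using nonneg by (intro exI[of _ 1]) auto
  ultimately have "0 \<le> h 0"
    by (rule tendsto_lowerbound) simp
  then show ?thesis by (simp add: h_def)
qed

text \<open>The function \<open>c\<^sub>i\<close> is the kernel of the quadratic form integrated in one variable, hence the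
density of the linear functional in \<open>first_variation\<close>.\<close>

lemma quant_cost_eq:
  assumes "\<pi> \<in> plans \<xi> n" "x \<in> space \<xi>" "i \<in> {1..n}"
  shows "quant_cost n g \<xi> G \<pi> i x = (\<integral>\<^sup>+w. pair_cost G ((x, i), w) \<partial>\<pi>)"
proof -
  have "(x, i) \<in> space (\<xi> \<Otimes>\<^sub>M count_space {1..n})"
    using assms by (simp add: space_pair_measure)
  then have "(\<lambda>w. ennreal (pair_cost G ((x, i), w))) \<in> borel_measurable (\<xi> \<Otimes>\<^sub>M count_space {1..n})"
    by (intro measurable_compose[OF measurable_Pair1'
          measurable_compose[OF pair_cost_measurable measurable_ennreal]])
  from nn_integral_plan[OF assms(1) this] show ?thesis
    by (simp add: quant_cost_def pair_cost_def)
qed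

lemma quant_cost_measurable:
  assumes "\<pi> \<in> plans \<xi> n" "i \<in> {1..n}"
  shows "quant_cost n g \<xi> G \<pi> i \<in> borel_measurable \<xi>"
proof -
  have "(\<lambda>x. \<integral>\<^sup>+w. pair_cost G ((x, i), w) \<partial>\<pi>) \<in> borel_measurable \<xi>"
    using assms(2) by (intro measurable_compose[OF _ inner_cost_measurable[OF assms(1)]]) auto
  then show ?thesis
    by (subst measurable_cong[OF quant_cost_eq[OF assms(1) _ assms(2)]])
qed

lemma quant_cost_plan_measurable:
  assumes "\<pi> \<in> plans \<xi> n"
  shows "(\<lambda>z. quant_cost n g \<xi> G \<pi> (snd z) (fst z)) \<in> borel_measurable (\<xi> \<Otimes>\<^sub>M count_space {1..n})"
proof (subst measurable_cong)
  fix z assume "z \<in> space (\<xi> \<Otimes>\<^sub>M count_space {1..n})"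
  then show "quant_cost n g \<xi> G \<pi> (snd z) (fst z) = (\<integral>\<^sup>+w. pair_cost G (z, w) \<partial>\<pi>)"
    by (auto simp: space_pair_measure quant_cost_eq[OF assms])
qed (rule inner_cost_measurable[OF assms])

lemma nn_integral_quant_cost:
  assumes \<pi>: "\<pi> \<in> plans \<xi> n" and \<rho>: "\<rho> \<in> plans \<xi> n"
  shows "(\<integral>\<^sup>+z. quant_cost n g \<xi> G \<pi> (snd z) (fst z) \<partial>\<rho>) = cross_distortion G \<rho> \<pi>"
proof -
  have "(\<integral>\<^sup>+z. quant_cost n g \<xi> G \<pi> (snd z) (fst z) \<partial>\<rho>) = (\<integral>\<^sup>+z. \<integral>\<^sup>+w. pair_cost G (z, w) \<partial>\<pi> \<partial>\<rho>)"
    by (intro nn_integral_cong) (auto simp: space_plan[OF \<rho>] quant_cost_eq[OF \<pi>])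
  then show ?thesis by (simp add: nn_integral_cross_distortion[OF \<rho> \<pi>])
qed

text \<open>Compare \<open>\<pi>\<close> with the plan \<open>\<rho>\<close> that sends each \<open>x\<close> to its Voronoi index. By \<open>first_variation\<close> the
integral of \<open>c\<^sub>i(x)\<close> under \<open>\<pi>\<close> is at most the one under \<open>\<rho>\<close>, which is the integral of the pointwise
minimum, and both plans give the same integral to the minimum because it depends on \<open>x\<close> alone.\<close>

lemma minimal_plan_AE_argmin:
  assumes \<pi>: "\<pi> \<in> plans \<xi> n"
    and G: "\<And>i j. i \<in> {1..n} \<Longrightarrow> j \<in> {1..n} \<Longrightarrow> G i j = G j i"
    and min: "\<And>\<sigma>. \<sigma> \<in> plans \<xi> n \<Longrightarrow> distortion G \<pi> \<le> distortion G \<sigma>"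
  defines "c \<equiv> quant_cost n g \<xi> G \<pi>"
  shows "AE z in \<pi>. c (snd z) (fst z) = (MIN j\<in>{1..n}. c j (fst z))"
proof -
  let ?M = "\<xi> \<Otimes>\<^sub>M count_space {1..n}"
  let ?m = "\<lambda>x. MIN j\<in>{1..n}. c j x"
  define T where "T = voronoi_index n c"
  have c: "c i \<in> borel_measurable \<xi>" if "i \<in> {1..n}" for i
    unfolding c_def by (rule quant_cost_measurable[OF \<pi> that])
  have m: "?m \<in> borel_measurable \<xi>" by (rule min_cost_measurable[OF c])
  have T: "T \<in> measurable \<xi> (count_space {1..n})"
    unfolding T_def by (rule voronoi_index_measurable[OF cells_pos c])
  define \<rho> where "\<rho> = distr \<xi> ?M (\<lambda>x. (x, T x))"
  have \<rho>: "\<rho> \<in> plans \<xi> n" unfolding \<rho>_def by (rule graph_plan[OF T])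
  have cz: "(\<lambda>z. c (snd z) (fst z)) \<in> borel_measurable ?M"
    unfolding c_def by (rule quant_cost_plan_measurable[OF \<pi>])
  have int_\<pi>: "(\<integral>\<^sup>+z. c (snd z) (fst z) \<partial>\<pi>) = distortion G \<pi>"
    unfolding c_def nn_integral_quant_cost[OF \<pi> \<pi>] ..
  also have "distortion G \<pi> \<le> cross_distortion G \<rho> \<pi>"
    using first_variation[OF \<pi> \<rho> G min] cross_distortion_commute[where G = G, OF \<pi> \<rho> G] by simp
  then have "ennreal (distortion G \<pi>) \<le> ennreal (cross_distortion G \<rho> \<pi>)"
    by (rule ennreal_leI)
  also have "\<dots> = (\<integral>\<^sup>+z. c (snd z) (fst z) \<partial>\<rho>)"
    unfolding c_def nn_integral_quant_cost[OF \<pi> \<rho>] ..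
  also have "\<dots> = (\<integral>\<^sup>+x. c (T x) x \<partial>\<xi>)"
    unfolding \<rho>_def using T cz by (subst nn_integral_distr) auto
  also have "\<dots> = (\<integral>\<^sup>+x. ?m x \<partial>\<xi>)"
    unfolding T_def voronoi_index_in(2)[OF cells_pos] ..
  also have "\<dots> = (\<integral>\<^sup>+z. ?m (fst z) \<partial>\<pi>)"
    by (rule nn_integral_plan_fst[OF \<pi> m, symmetric])
  finally have le: "(\<integral>\<^sup>+z. c (snd z) (fst z) \<partial>\<pi>) \<le> (\<integral>\<^sup>+z. ?m (fst z) \<partial>\<pi>)" .
  show ?thesis
  proof (rule AE_eq_of_nn_integral_le[OF _ _ _ le])
    show "(\<lambda>z. ?m (fst z)) \<in> borel_measurable \<pi>"
      using measurable_compose[OF measurable_fst m] by (simp add: measurable_plan[OF \<pi>])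
    show "(\<lambda>z. c (snd z) (fst z)) \<in> borel_measurable \<pi>"
      using cz by (simp add: measurable_plan[OF \<pi>])
    show "?m (fst z) \<le> c (snd z) (fst z)" if "z \<in> space \<pi>" for z
      using that by (intro Min_le) (auto simp: space_plan[OF \<pi>])
    show "(\<integral>\<^sup>+z. c (snd z) (fst z) \<partial>\<pi>) < \<infinity>"
      by (simp add: int_\<pi>)
  qed
qed

lemma gauge_sum_graph:
  assumes T: "T \<in> measurable \<xi> (count_space {1..n})" and ij: "i \<in> {1..n}" "j \<in> {1..n}"
  defines "\<pi> \<equiv> distr \<xi> (\<xi> \<Otimes>\<^sub>M count_space {1..n}) (\<lambda>x. (x, T x))"
    and "V \<equiv> \<lambda>i. {x \<in> space \<xi>. T x = i}"
  shows "mass \<pi> i = measure \<xi> (V i)"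
    and "gauge_sum \<pi> i j = (LINT p : V i \<times> V j | \<xi> \<Otimes>\<^sub>M \<xi>. g (fst p) (snd p))"
proof -
  have V: "V k \<in> sets \<xi>" if "k \<in> {1..n}" for k
  proof -
    have "V k = T -` {k} \<inter> space \<xi>" by (auto simp: V_def)
    then show ?thesis using measurable_sets[OF T, of "{k}"] that by simp
  qed
  have slice: "slice \<xi> \<pi> k = density \<xi> (indicator (V k))" if "k \<in> {1..n}" for k
    unfolding \<pi>_def V_def by (rule slice_graph[OF T that])
  have \<pi>: "\<pi> \<in> plans \<xi> n" unfolding \<pi>_def by (rule graph_plan[OF T])
  have "emeasure (density \<xi> (indicator (V i))) (space \<xi>) = emeasure \<xi> (V i)"
    using V[OF ij(1)] sets.sets_into_space[OF V[OF ij(1)]]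
    by (subst emeasure_density) (auto simp: indicator_inter_arith[symmetric] Int_absorb2)
  then show "mass \<pi> i = measure \<xi> (V i)"
    by (simp add: mass_def slice[OF ij(1)] measure_def)
  have "block \<pi> \<pi> i j = density (\<xi> \<Otimes>\<^sub>M \<xi>) (\<lambda>(x, y). indicator (V i) x * indicator (V j) y)"
    unfolding slice[OF ij(1)] slice[OF ij(2)]
  proof (rule pair_measure_density)
    show "sigma_finite_measure (density \<xi> (indicator (V j)))"
      using finite_measure.axioms(1)[OF finite_measure_slice[OF prob_space_axioms \<pi> ij(2)]]
      by (simp add: slice[OF ij(2)])
  qed (use V ij in \<open>auto intro: sigma_finite_measure_axioms\<close>)
  also have "(\<lambda>(x, y). indicator (V i) x * indicator (V j) y) = (\<lambda>p. ennreal (indicator (V i \<times> V j) p))"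
    by (auto simp: fun_eq_iff indicator_def)
  finally have "gauge_sum \<pi> i j
    = (\<integral>p. g (fst p) (snd p) \<partial>density (\<xi> \<Otimes>\<^sub>M \<xi>) (\<lambda>p. ennreal (indicator (V i \<times> V j) p)))"
    by (simp add: gauge_sum_def)
  also have "\<dots> = (LINT p : V i \<times> V j | \<xi> \<Otimes>\<^sub>M \<xi>. g (fst p) (snd p))"
    unfolding set_lebesgue_integral_def
    using V ij gauge_measurable by (intro integral_density) auto
  finally show "gauge_sum \<pi> i j = (LINT p : V i \<times> V j | \<xi> \<Otimes>\<^sub>M \<xi>. g (fst p) (snd p))" .
qed

end

section \<open>The quantization problem\<close>

context gauged_space
begin

text \<open>Needed because an infimum over an empty set of couplings would have no meaning in the reals.\<close>

lemma couplings_nonempty: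
  assumes "prob_space \<upsilon>"
  shows "\<xi> \<Otimes>\<^sub>M \<upsilon> \<in> couplings \<xi> \<upsilon>"
proof -
  interpret \<upsilon>: prob_space \<upsilon> by fact
  interpret P: pair_prob_space \<xi> \<upsilon> ..
  have "distr (\<xi> \<Otimes>\<^sub>M \<upsilon>) \<upsilon> snd = \<upsilon>"
  proof (rule measure_eqI)
    fix A assume "A \<in> sets (distr (\<xi> \<Otimes>\<^sub>M \<upsilon>) \<upsilon> snd)"
    then have A: "A \<in> sets \<upsilon>" by simp
    have "snd -` A \<inter> space (\<xi> \<Otimes>\<^sub>M \<upsilon>) = space \<xi> \<times> A"
      using sets.sets_into_space[OF A] by (auto simp: space_pair_measure)
    then show "emeasure (distr (\<xi> \<Otimes>\<^sub>M \<upsilon>) \<upsilon> snd) A = emeasure \<upsilon> A"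
      using A by (simp add: emeasure_distr \<upsilon>.emeasure_pair_measure_Times emeasure_space_1)
  qed simp
  then show ?thesis
    using \<upsilon>.distr_pair_fst[of \<xi>] P.prob_space_axioms by (simp add: couplings_def)
qed

lemma GW2_lower_bound:
  assumes \<upsilon>: "sets \<upsilon> = Pow {1..n}" "prob_space \<upsilon>"
    and d: "\<And>\<pi>. \<pi> \<in> plans \<xi> n \<Longrightarrow> d \<le> distortion G \<pi>"
  shows "sqrt d \<le> GW2 (X, g, \<xi>) (Y, G, \<upsilon>)"
  unfolding GW2.simps
proof (rule cINF_greatest)
  show "couplings \<xi> \<upsilon> \<noteq> {}" using couplings_nonempty[OF \<upsilon>(2)] by auto
  fix \<pi> assume "\<pi> \<in> couplings \<xi> \<upsilon>"
  from coupling_is_plan[OF \<upsilon>(1) this] show "sqrt d \<le> gw_cost g G \<pi>"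
    by (simp add: gw_cost_eq_distortion d)
qed

lemma GW2_optimal_coupling:
  assumes "sets \<upsilon> = Pow {1..n}" "\<pi> \<in> optimal_couplings (X, g, \<xi>) (Y, G, \<upsilon>)"
  shows "\<pi> \<in> plans \<xi> n" "GW2 (X, g, \<xi>) (Y, G, \<upsilon>) = sqrt (distortion G \<pi>)"
proof -
  show \<pi>: "\<pi> \<in> plans \<xi> n" using assms coupling_is_plan by auto
  have "GW2 (X, g, \<xi>) (Y, G, \<upsilon>) = gw_cost g G \<pi>"
    unfolding GW2.simps using assms(2) by (intro cInf_eq_minimum) auto
  then show "GW2 (X, g, \<xi>) (Y, G, \<upsilon>) = sqrt (distortion G \<pi>)"
    by (simp add: gw_cost_eq_distortion[OF \<pi>])
qed

text \<open>A joint minimizer \<open>(G, \<pi>)\<close> of the distortion yields a solution: its weights are the second marginal of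
\<open>\<pi>\<close>, and \<open>\<pi>\<close> is an optimal coupling for them. The number \<open>d\<close> is the minimal distortion.\<close>

lemma q_GW_attained:
  obtains d \<Y> where "\<Y> \<in> GM n" "GW2 (X, g, \<xi>) \<Y> = q_GW n (X, g, \<xi>)"
    "q_GW n (X, g, \<xi>) = sqrt d" "\<And>G \<pi>. \<pi> \<in> plans \<xi> n \<Longrightarrow> d \<le> distortion G \<pi>"
proof -
  obtain G \<pi> where G: "\<And>i j. i \<in> {1..n} \<Longrightarrow> j \<in> {1..n} \<Longrightarrow> G i j = G j i" and \<pi>: "\<pi> \<in> plans \<xi> n"
    and min: "\<And>G' \<pi>'. \<pi>' \<in> plans \<xi> n \<Longrightarrow> distortion G \<pi> \<le> distortion G' \<pi>'"
    by (rule distortion_minimizer_exists) (rule that; blast)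
  define \<upsilon> where "\<upsilon> = distr \<pi> (count_space {1..n}) snd"
  define \<Y> where "\<Y> = (discrete_topology {1..n}, G, \<upsilon>)"
  \<comment> \<open>The weights of the quantizer are chosen so that the minimizing plan couples them.\<close>
  note coupling = plan_is_coupling[OF prob_space_axioms \<pi>, folded \<upsilon>_def]
  have Y: "\<Y> \<in> GM n"
    unfolding GM_def \<Y>_def using coupling(1) G by (auto simp: \<upsilon>_def)
  have lower: "sqrt (distortion G \<pi>) \<le> GW2 (X, g, \<xi>) \<Y>'" if "\<Y>' \<in> GM n" for \<Y>'
    using that min by (auto simp: GM_def simp del: GW2.simps intro!: GW2_lower_bound)
  have "bdd_below (gw_cost g G ` couplings \<xi> \<upsilon>)"
    by (intro bdd_belowI2[of _ 0]) (simp add: gw_cost_def integral_nonneg_AE case_prod_beta')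
  then have "GW2 (X, g, \<xi>) \<Y> \<le> sqrt (distortion G \<pi>)"
    unfolding \<Y>_def GW2.simps gw_cost_eq_distortion[OF \<pi>, symmetric]
    by (rule cINF_lower[OF _ coupling(2)])
  with lower[OF Y] have eq: "GW2 (X, g, \<xi>) \<Y> = sqrt (distortion G \<pi>)" by simp
  have "q_GW n (X, g, \<xi>) = sqrt (distortion G \<pi>)"
    unfolding q_GW_def
    by (rule cInf_eq_minimum) (use Y eq[symmetric] lower in auto)
  with that[OF Y _ this min] eq show thesis by simp
qed

end

theorem theorem3p4:
  fixes X :: "'a topology" and g :: "'a \<Rightarrow> 'a \<Rightarrow> real" and \<xi> :: "'a measure" and n :: nat
  assumes "gm_space (X, g, \<xi>)" and "n \<ge> 1"
  shows "(\<exists>\<Y>\<in>GM n. GW2 (X, g, \<xi>) \<Y> = q_GW n (X, g, \<xi>)) \<and>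
    (\<forall>G \<upsilon> \<pi>.
      let \<Y> = (discrete_topology {1..n}, G, \<upsilon>);
          c = quant_cost n g \<xi> G \<pi>;
          A = argmin_set X n c;
          T = voronoi_index n c;
          V = voronoi_cell X n c
      in \<Y> \<in> GM n \<and> GW2 (X, g, \<xi>) \<Y> = q_GW n (X, g, \<xi>) \<and>
         (\<forall>i\<in>{1..n}. measure \<upsilon> {i} > 0) \<and> \<pi> \<in> optimal_couplings (X, g, \<xi>) \<Y> \<longrightarrow>
         (\<forall>i\<in>{1..n}. \<forall>i'\<in>{1..n}.
            G i i' = 1 / (measure \<upsilon> {i} * measure \<upsilon> {i'}) *
              (\<integral>(x, x'). g x x' \<partial>(slice \<xi> \<pi> i \<Otimes>\<^sub>M slice \<xi> \<pi> i'))) \<and>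
         (\<forall>i\<in>{1..n}. concentrated_on (slice \<xi> \<pi> i) (A i)) \<and>
         (q_GW n (X, g, \<xi>))\<^sup>2 = (GW2 (X, g, \<xi>) \<Y>)\<^sup>2 \<and>
         (GW2 (X, g, \<xi>) \<Y>)\<^sup>2 =
            (\<integral>(x, x'). (g x x')\<^sup>2 \<partial>(\<xi> \<Otimes>\<^sub>M \<xi>)) -
            (\<Sum>i\<in>{1..n}. \<Sum>i'\<in>{1..n}. (G i i')\<^sup>2 * measure \<upsilon> {i} * measure \<upsilon> {i'}) \<and>
         ((\<forall>i\<in>{1..n}. \<forall>j\<in>{1..n}. i \<noteq> j \<longrightarrow> emeasure \<xi> (A i \<inter> A j) = 0) \<longrightarrow>
            \<pi> = distr \<xi> (\<xi> \<Otimes>\<^sub>M \<upsilon>) (\<lambda>x. (x, T x)) \<and>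
            \<upsilon> = point_measure {1..n} (\<lambda>i. emeasure \<xi> (V i)) \<and>
            (\<forall>i\<in>{1..n}. \<forall>i'\<in>{1..n}.
               G i i' = 1 / (measure \<xi> (V i) * measure \<xi> (V i')) *
                 (LINT (x, x') : V i \<times> V i' | \<xi> \<Otimes>\<^sub>M \<xi>. g x x'))))"
proof -
  have \<xi>: "sets \<xi> = sigma_sets (topspace X) {U. openin X U}" "prob_space \<xi>"
    using assms(1) by simp_all
  interpret gauged_space \<xi> g n
    by (rule gauged_space.intro[OF \<xi>(2)], unfold_locales)
       (use assms in \<open>simp_all add: case_prod_beta'\<close>)
  have "{U. openin X U} \<subseteq> Pow (topspace X)" by (auto dest: openin_subset)
  then have space: "space \<xi> = topspace X"
    using sets_eq_imp_space_eq[of \<xi> "measure_of (topspace X) {U. openin X U} (\<lambda>_. 0)"] \<xi>(1)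
    by (simp add: space_measure_of)
  obtain d \<Y>0 where Y0: "\<Y>0 \<in> GM n" "GW2 (X, g, \<xi>) \<Y>0 = q_GW n (X, g, \<xi>)"
    and q: "q_GW n (X, g, \<xi>) = sqrt d"
    and d: "\<And>G \<pi>. \<pi> \<in> plans \<xi> n \<Longrightarrow> d \<le> distortion G \<pi>"
    by (rule q_GW_attained) (rule that; blast)
  show ?thesis
    unfolding Let_def
  proof (intro conjI allI impI)
    show "\<exists>\<Y>\<in>GM n. GW2 (X, g, \<xi>) \<Y> = q_GW n (X, g, \<xi>)" using Y0 by blast
  next
    fix G :: "nat \<Rightarrow> nat \<Rightarrow> real" and \<upsilon> :: "nat measure" and \<pi> :: "('a \<times> nat) measure"
    define \<Y> where "\<Y> = (discrete_topology {1..n}, G, \<upsilon>)"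
    define c where "c = quant_cost n g \<xi> G \<pi>"
    define T where "T = voronoi_index n c"
    assume asm: "(discrete_topology {1..n}, G, \<upsilon>) \<in> GM n \<and>
      GW2 (X, g, \<xi>) (discrete_topology {1..n}, G, \<upsilon>) = q_GW n (X, g, \<xi>) \<and>
      (\<forall>i\<in>{1..n}. 0 < measure \<upsilon> {i}) \<and>
      \<pi> \<in> optimal_couplings (X, g, \<xi>) (discrete_topology {1..n}, G, \<upsilon>)"
    then have sol: "GW2 (X, g, \<xi>) \<Y> = q_GW n (X, g, \<xi>)"
      and pos: "\<And>i. i \<in> {1..n} \<Longrightarrow> 0 < measure \<upsilon> {i}"
      and opt: "\<pi> \<in> optimal_couplings (X, g, \<xi>) \<Y>"
      unfolding \<Y>_def by blast+
    have \<upsilon>: "sets \<upsilon> = Pow {1..n}" "prob_space \<upsilon>"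
      and G: "\<And>i j. i \<in> {1..n} \<Longrightarrow> j \<in> {1..n} \<Longrightarrow> G i j = G j i"
      using asm by (auto simp: GM_def simp del: GW2.simps optimal_couplings.simps)
    have coupling: "\<pi> \<in> couplings \<xi> \<upsilon>" using opt by (simp add: \<Y>_def)
    note \<pi> = GW2_optimal_coupling[OF \<upsilon>(1) opt[unfolded \<Y>_def], folded \<Y>_def]
    have mass: "mass \<pi> i = measure \<upsilon> {i}" if "i \<in> {1..n}" for i
      unfolding mass_def by (rule measure_slice_space[OF \<upsilon>(1) coupling that])
    have massp: "0 < mass \<pi> i" if "i \<in> {1..n}" for i using pos mass that by simp
    \<comment> \<open>Optimality of both the quantizer and the coupling makes \<open>(G, \<pi>)\<close> a joint minimizer.\<close>
    have d_eq: "distortion G \<pi> = d" using \<pi>(2) sol q by simp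
    then have min: "distortion G \<pi> \<le> distortion G' \<pi>'" if "\<pi>' \<in> plans \<xi> n" for G' \<pi>'
      using d that by simp
    have mean: "G i j = gauge_mean \<pi> i j" if "i \<in> {1..n}" "j \<in> {1..n}" for i j
      by (rule optimal_gauge_is_mean[OF \<pi>(1) massp min[OF \<pi>(1)] that])
    have argmin: "AE z in \<pi>. c (snd z) (fst z) = (MIN j\<in>{1..n}. c j (fst z))"
      unfolding c_def by (rule minimal_plan_AE_argmin[OF \<pi>(1) G min])
    have c: "c i \<in> borel_measurable \<xi>" if "i \<in> {1..n}" for i
      unfolding c_def by (rule quant_cost_measurable[OF \<pi>(1) that])
    show "\<forall>i\<in>{1..n}. \<forall>i'\<in>{1..n}.
        G i i' = 1 / (measure \<upsilon> {i} * measure \<upsilon> {i'}) *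
          (\<integral>(x, x'). g x x' \<partial>(slice \<xi> \<pi> i \<Otimes>\<^sub>M slice \<xi> \<pi> i'))"
      using mean by (simp add: gauge_mean_def gauge_sum_def mass case_prod_beta')
    show "\<forall>i\<in>{1..n}. concentrated_on (slice \<xi> \<pi> i) (argmin_set X n (quant_cost n g \<xi> G \<pi>) i)"
    proof
      fix i assume i: "i \<in> {1..n}"
      note [measurable] = c[OF i] min_cost_measurable[OF c]
      define B where "B = {x \<in> space \<xi>. c i x \<noteq> (MIN j\<in>{1..n}. c j x)}"
      have B: "B \<in> sets \<xi>" unfolding B_def by measurable
      have "AE z in \<pi>. z \<notin> B \<times> {i}"
        using argmin by eventually_elim (auto simp: B_def)
      moreover have "B \<times> {i} \<in> sets \<pi>" using B i by (auto simp: sets_plan[OF \<pi>(1)])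
      ultimately have "emeasure \<pi> (B \<times> {i}) = 0"
        by (subst (asm) AE_iff_measurable[of "B \<times> {i}"]) (auto dest: sets.sets_into_space)
      then have "B \<in> null_sets (slice \<xi> \<pi> i)"
        using B by (simp add: null_sets_def emeasure_slice_plan[OF \<pi>(1) i])
      moreover have "space (slice \<xi> \<pi> i) - argmin_set X n c i = B"
        by (auto simp: argmin_set_def B_def space)
      ultimately show "concentrated_on (slice \<xi> \<pi> i) (argmin_set X n (quant_cost n g \<xi> G \<pi>) i)"
        by (simp add: concentrated_on_def c_def)
    qed
    show "(q_GW n (X, g, \<xi>))\<^sup>2 = (GW2 (X, g, \<xi>) (discrete_topology {1..n}, G, \<upsilon>))\<^sup>2"
      using sol by (simp add: \<Y>_def del: GW2.simps)
    show "(GW2 (X, g, \<xi>) (discrete_topology {1..n}, G, \<upsilon>))\<^sup>2 =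
        (\<integral>(x, x'). (g x x')\<^sup>2 \<partial>(\<xi> \<Otimes>\<^sub>M \<xi>)) -
        (\<Sum>i\<in>{1..n}. \<Sum>i'\<in>{1..n}. (G i i')\<^sup>2 * measure \<upsilon> {i} * measure \<upsilon> {i'})"
      using \<pi>(2) cross_distortion_nonneg[of G \<pi> \<pi>] distortion_at_mean[OF \<pi>(1) massp mean]
      by (simp add: \<Y>_def mass case_prod_beta' del: GW2.simps)
    assume "\<forall>i\<in>{1..n}. \<forall>j\<in>{1..n}. i \<noteq> j \<longrightarrow>
      emeasure \<xi> (argmin_set X n (quant_cost n g \<xi> G \<pi>) i \<inter> argmin_set X n (quant_cost n g \<xi> G \<pi>) j) = 0"
    moreover have "argmin_set X n (quant_cost n g \<xi> G \<pi>) i \<inter> argmin_set X n (quant_cost n g \<xi> G \<pi>) j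
      = {x \<in> space \<xi>. c i x = (MIN k\<in>{1..n}. c k x) \<and> c j x = (MIN k\<in>{1..n}. c k x)}" for i j
      by (auto simp: argmin_set_def c_def space)
    ultimately have "AE z in \<pi>. snd z = T (fst z)"
      unfolding T_def by (intro AE_snd_voronoi_index[OF \<pi>(1) cells_pos c argmin]) auto
    have T: "T \<in> measurable \<xi> (count_space {1..n})"
      unfolding T_def by (rule voronoi_index_measurable[OF cells_pos c])
    have graph: "\<pi> = distr \<xi> (\<xi> \<Otimes>\<^sub>M count_space {1..n}) (\<lambda>x. (x, T x))"
      by (rule plan_eq_graph[OF \<pi>(1) T]) fact
    then show "\<pi> = distr \<xi> (\<xi> \<Otimes>\<^sub>M \<upsilon>) (\<lambda>x. (x, voronoi_index n (quant_cost n g \<xi> G \<pi>) x))"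
      unfolding T_def c_def
      using distr_cong[OF refl sets_pair_measure_cong[OF refl, of \<upsilon> "count_space {1..n}"]] \<upsilon>(1)
      by (metis sets_count_space)
    have V: "voronoi_cell X n (quant_cost n g \<xi> G \<pi>) i = {x \<in> space \<xi>. T x = i}" for i
      by (simp add: voronoi_cell_def T_def c_def space)
    note graph_sums = gauge_sum_graph[OF T, folded graph V]
    interpret \<upsilon>: prob_space \<upsilon> by fact
    show "\<upsilon> = point_measure {1..n} (\<lambda>i. emeasure \<xi> (voronoi_cell X n (quant_cost n g \<xi> G \<pi>) i))"
    proof (rule measure_eqI_finite[OF \<upsilon>(1)])
      fix i assume i: "i \<in> {1..n}"
      then show "emeasure \<upsilon> {i} = emeasure (point_measure {1..n}
          (\<lambda>i. emeasure \<xi> (voronoi_cell X n (quant_cost n g \<xi> G \<pi>) i))) {i}"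
        using mass[OF i] graph_sums(1)[OF i i]
        by (simp add: emeasure_point_measure_finite emeasure_eq_measure \<upsilon>.emeasure_eq_measure)
    qed (simp_all add: sets_point_measure)
    show "\<forall>i\<in>{1..n}. \<forall>i'\<in>{1..n}. G i i' =
        1 / (measure \<xi> (voronoi_cell X n (quant_cost n g \<xi> G \<pi>) i) *
             measure \<xi> (voronoi_cell X n (quant_cost n g \<xi> G \<pi>) i')) *
        (LINT (x, x') : voronoi_cell X n (quant_cost n g \<xi> G \<pi>) i \<times>
            voronoi_cell X n (quant_cost n g \<xi> G \<pi>) i' | \<xi> \<Otimes>\<^sub>M \<xi>. g x x')"
    proof (intro ballI)
      fix i j assume ij: "i \<in> {1..n}" "j \<in> {1..n}"
      show "G i j = 1 / (measure \<xi> (voronoi_cell X n (quant_cost n g \<xi> G \<pi>) i) *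
             measure \<xi> (voronoi_cell X n (quant_cost n g \<xi> G \<pi>) j)) *
        (LINT (x, x') : voronoi_cell X n (quant_cost n g \<xi> G \<pi>) i \<times>
            voronoi_cell X n (quant_cost n g \<xi> G \<pi>) j | \<xi> \<Otimes>\<^sub>M \<xi>. g x x')"
        unfolding mean[OF ij] gauge_mean_def graph_sums(2)[OF ij]
          graph_sums(1)[OF ij] graph_sums(1)[OF ij(2) ij(2)]
        by (simp add: case_prod_beta')
    qed
  qed
qed

end
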